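(* Consider the online protocol and the OMMA algorithm described in the context, in the multi-class or the multi-label classification setting with $m$ classes/labels. Suppose the utility $\psi(C)$ is differentiable, concave, $L$-Lipschitz and $M$-smooth in $C$, that is, for any $C_1,C_2\in\mathcal{C}$ (the set of all achievable confusion matrices), $$\psi(C_1)\le\psi(C_2)+\nabla\psi(C_2)\cdot(C_1-C_2),\quad |\psi(C_1)-\psi(C_2)|\le L\|C_1-C_2\|,\quad \|\nabla\psi(C_1)-\nabla\psi(C_2)\|\le M\|C_1-C_2\|.$$ Then the OMMA algorithm has its regret bounded by $$R_n\le\frac{Ma(1+\ln n)}{n}+\frac{2bL}{n}\sum_{t=1}^n\mathbb{E}\big[\|\eta(x_t)-\widehat\eta_t(x_t)\|\big],$$ where $a=1,\ b=1$ for multi-class classification, and $a=m,\ b=\sqrt2$ for multi-label classification.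
   Context: Data. $(x,y)\sim\mathbb{P}$ with input $x\in\mathcal{X}$ and output label vector $y\in\mathcal{Y}\subseteq\{0,1\}^m$; $\eta(x)=\mathbb{E}[y\mid x]$ is the vector with entries $\eta_j(x)=\mathbb{P}(y_j=1\mid x)$. In multi-class classification, $\mathcal{Y}=\{y\in\{0,1\}^m:\sum_j y_j=1\}$ (one-hot vectors); in multi-label classification, $y\in\{0,1\}^m$ is the vector of relevant labels. Predictions $\widehat y$ are taken from a set of allowed predictions (one-hot vectors in multi-class classification; vectors in $\{0,1\}^m$ in multi-label classification, or, in the variant budgeted at $k$, those with exactly $k$ ones). Confusion matrices. For a single pair $(y,\widehat y)$: in the multi-class case $C(y,\widehat y)$ is the $m\times m$ matrix with entries $C_{j\ell}=y_j\widehat y_\ell$; in the multi-label case $C(y,\widehat y)$ is the $m\times2\times2$ tensor with entries $C_{juv}=\mathbf 1\{y_j=u\}\mathbf 1\{\widehat y_j=v\}$, $u,v\in\{0,1\}$. For sequences $y^n=(y_1,\dots,y_n)$, $\widehat y^n=(\widehat y_1,\dots,\widehat y_n)$, the empirical confusion matrix is $C(y^n,\widehat y^n)=\frac1n\sum_{t=1}^nC(y_t,\widehat y_t)$. $\mathcal{C}$ denotes the set of all achievable confusion matrices, i.e. those of the form $C(y^t,\widehat y^t)$ for allowed label and prediction vectors and any $t$. Since $C(y,\widehat y)$ depends on $y$ in such a way that its expectation over $y$ (for fixed $\widehat y$) depends only on the marginals $\mathbb{E}[y]$, we write $\mathbb{E}_{y\sim q}[C(y,\widehat y)]$ for this expectation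 when $\mathbb{E}[y]=q$. The utility $\psi$ is a real-valued function of the confusion matrix; $\nabla\psi(C)$ is the array of partial derivatives of $\psi$ (same shape as $C$), $\cdot$ is the entrywise dot product, and $\|\cdot\|$ is the entrywise $L_2$-norm. Online protocol. $(x_1,y_1),\dots,(x_n,y_n)$ are drawn i.i.d. from $\mathbb{P}$. At each trial $t=1,\dots,n$ the algorithm observes $x_t$, receives an estimate $\widehat\eta_t(x_t)$ of the conditional distribution $\eta(x_t)$, where $\widehat\eta_t$ can depend only on $x_t,(x_1,y_1),\dots,(x_{t-1},y_{t-1})$, makes a prediction $\widehat y_t$, and then observes $y_t$. At the end it is evaluated by $\psi(C(y^n,\widehat y^n))$. OMMA (Online Metric Maximization Algorithm). Start from an initial confusion matrix $C_0$. At trial $t$, predict $$\widehat y_t=\arg\max_{\widehat y}\ \nabla\psi(C_{t-1})\cdot\mathbb{E}_{y_t\sim\widehat\eta_t(x_t)}[C(y_t,\widehat y)],$$ with the maximization over the allowed predictions, and after observing $y_t$ set $C_t=\frac{t-1}{t}C_{t-1}+\frac1tC(y_t,\widehat y_t)$ (so that $C_t=C(y^t,\widehat y^t)$ for $t\ge1$). Regret. A classifier is a function $h:\mathcal{X}\to\mathcal{Y}$, and $h(x^n)=(h(x_1),\dots,h(x_n))$. Let $h^\star=\arg\max_h\mathbb{E}_{(x,y)^n}[\psi(C(y^n,h(x^n)))]$, the maximization being over all measurable classifiers. The regret is $R_n=\mathbb{E}[\psi(C(y^n,h^\star(x^n)))]-\mathbb{E}[\psi(C(y^n,\widehat y^n))]$.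 *)

theory Defs
  imports "HOL-Probability.Probability"
begin

definition binary_vectors :: "(real ^ 'm) set" where
  "binary_vectors = {y. \<forall>j. y $ j \<in> {0, 1}}"

definition one_hot_vectors :: "(real ^ 'm) set" where
  "one_hot_vectors = {y \<in> binary_vectors. (\<Sum>j\<in>UNIV. y $ j) = 1}"

definition budgeted_vectors :: "nat \<Rightarrow> (real ^ 'm) set" where
  "budgeted_vectors k = {y \<in> binary_vectors. (\<Sum>j\<in>UNIV. y $ j) = real k}"

definition multiclass_confusion :: "real ^ 'm \<Rightarrow> real ^ 'm \<Rightarrow> real ^ 'm ^ 'm" where
  "multiclass_confusion y yh = (\<chi> j l. y $ j * yh $ l)"

(* The m x 2 x 2 tensor; the index set {0, 1} of the last two axes is rendered as bool.
   The nested library norm and inner product are the entrywise ones. *)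
definition multilabel_confusion :: "real ^ 'm \<Rightarrow> real ^ 'm \<Rightarrow> real ^ bool ^ bool ^ 'm" where
  "multilabel_confusion y yh =
     (\<chi> j u v. of_bool (y $ j = of_bool u) * of_bool (yh $ j = of_bool v))"

definition empirical_confusion ::
    "('v \<Rightarrow> 'v \<Rightarrow> 'c::real_vector) \<Rightarrow> nat \<Rightarrow> (nat \<Rightarrow> 'v) \<Rightarrow> (nat \<Rightarrow> 'v) \<Rightarrow> 'c" where
  "empirical_confusion conf n y yh = (1 / real n) *\<^sub>R (\<Sum>t = 1..n. conf (y t) (yh t))"

definition achievable_confusions ::
    "('v \<Rightarrow> 'v \<Rightarrow> 'c::real_vector) \<Rightarrow> 'v set \<Rightarrow> 'v set \<Rightarrow> 'c set" where
  "achievable_confusions conf Y P =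
     {empirical_confusion conf t y yh | t y yh. t \<ge> 1 \<and> (\<forall>s\<in>{1..t}. y s \<in> Y \<and> yh s \<in> P)}"

(* The expectation of C(y, yh) over any distribution of y on Y with mean q. For the two confusion
   maps above it does not depend on the distribution chosen (expectation_multiclass_confusion and
   expectation_multilabel_confusion below). *)
definition expected_confusion ::
    "('v \<Rightarrow> 'v \<Rightarrow> 'c::euclidean_space) \<Rightarrow> 'v set \<Rightarrow> 'v::euclidean_space \<Rightarrow> 'v \<Rightarrow> 'c" where
  "expected_confusion conf Y q yh =
     measure_pmf.expectation
       (SOME p. set_pmf p \<subseteq> Y \<and> measure_pmf.expectation p (\<lambda>y. y) = q)
       (\<lambda>y. conf y yh)"

(* psi is differentiable on S with gradient grad, and concave, L-Lipschitz and M-smooth on S. *)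
definition concave_smooth_utility ::
    "'c::euclidean_space set \<Rightarrow> ('c \<Rightarrow> real) \<Rightarrow> ('c \<Rightarrow> 'c) \<Rightarrow> real \<Rightarrow> real \<Rightarrow> bool" where
  "concave_smooth_utility S \<psi> grad L M \<longleftrightarrow>
     (\<forall>C\<in>S. GDERIV \<psi> C :> grad C) \<and>
     (\<forall>C1\<in>S. \<forall>C2\<in>S. \<psi> C1 \<le> \<psi> C2 + grad C2 \<bullet> (C1 - C2)) \<and>
     L-lipschitz_on S \<psi> \<and>
     M-lipschitz_on S grad"

(* The law of the i.i.d. sample (x_1, y_1), ..., (x_n, y_n); trials are numbered from 1. *)
abbreviation sample_law :: "nat \<Rightarrow> 'z measure \<Rightarrow> (nat \<Rightarrow> 'z) measure" where
  "sample_law n D \<equiv> PiM {1..n} (\<lambda>_. D)"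

(* The observations available before trial t. *)
abbreviation past_law :: "nat \<Rightarrow> 'z measure \<Rightarrow> (nat \<Rightarrow> 'z) measure" where
  "past_law t D \<equiv> PiM {1..<t} (\<lambda>_. D)"

(* The value at trial t of a rule g that sees the trial number, the past and the current input. *)
definition at_trial ::
    "(nat \<Rightarrow> (nat \<Rightarrow> 'x \<times> 'v) \<Rightarrow> 'x \<Rightarrow> 'b) \<Rightarrow> nat \<Rightarrow> (nat \<Rightarrow> 'x \<times> 'v) \<Rightarrow> 'b" where
  "at_trial g t z = g t (restrict z {1..<t}) (fst (z t))"

definition data_distribution :: "'x measure \<Rightarrow> 'v set \<Rightarrow> ('x \<times> 'v) measure \<Rightarrow> bool" where
  "data_distribution X Y D \<longleftrightarrow> prob_space D \<and> sets D = sets (X \<Otimes>\<^sub>M count_space Y)"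

(* eta is a version of the conditional expectation of y given x. *)
definition conditional_label_mean ::
    "'x measure \<Rightarrow> ('x \<times> (real ^ 'm)) measure \<Rightarrow> ('x \<Rightarrow> real ^ 'm) \<Rightarrow> bool" where
  "conditional_label_mean X D \<eta> \<longleftrightarrow>
     \<eta> \<in> borel_measurable X \<and>
     (\<forall>j. AE z in D. \<eta> (fst z) $ j =
        real_cond_exp D (vimage_algebra (space D) fst X) (\<lambda>z. snd z $ j) z)"

(* The estimates are means of distributions on Y, i.e. points of its convex hull: the probability
   simplex for one-hot labels, the unit cube for arbitrary binary labels. *)
definition online_estimator ::
    "'x measure \<Rightarrow> 'v set \<Rightarrow> ('x \<times> 'v) measure \<Rightarrow> nat \<Rightarrow>
     (nat \<Rightarrow> (nat \<Rightarrow> 'x \<times> 'v) \<Rightarrow> 'x \<Rightarrow> 'v::euclidean_space) \<Rightarrow> bool" where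
  "online_estimator X Y D n \<eta>h \<longleftrightarrow>
     (\<forall>t\<in>{1..n}.
        (\<lambda>(past, x). \<eta>h t past x) \<in> borel_measurable (past_law t D \<Otimes>\<^sub>M X) \<and>
        (\<forall>past\<in>space (past_law t D). \<forall>x\<in>space X. \<eta>h t past x \<in> convex hull Y))"

primrec omma_confusion ::
    "('v \<Rightarrow> 'v \<Rightarrow> 'c::real_vector) \<Rightarrow> 'c \<Rightarrow>
     (nat \<Rightarrow> (nat \<Rightarrow> 'x \<times> 'v) \<Rightarrow> 'x \<Rightarrow> 'v) \<Rightarrow> (nat \<Rightarrow> 'x \<times> 'v) \<Rightarrow> nat \<Rightarrow> 'c" where
  "omma_confusion conf C0 pred z 0 = C0"
| "omma_confusion conf C0 pred z (Suc t) =
     (real t / real (Suc t)) *\<^sub>R omma_confusion conf C0 pred z t +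
     (1 / real (Suc t)) *\<^sub>R conf (snd (z (Suc t))) (at_trial pred (Suc t) z)"

(* Ties in the argmax may be broken by any measurable rule, which, like the prediction itself, sees
   only the past and the current input. *)
definition omma ::
    "('v \<Rightarrow> 'v \<Rightarrow> 'c::euclidean_space) \<Rightarrow> 'x measure \<Rightarrow> 'v set \<Rightarrow> 'v set \<Rightarrow>
     ('x \<times> 'v) measure \<Rightarrow> nat \<Rightarrow> ('c \<Rightarrow> 'c) \<Rightarrow> 'c \<Rightarrow>
     (nat \<Rightarrow> (nat \<Rightarrow> 'x \<times> 'v) \<Rightarrow> 'x \<Rightarrow> 'v::euclidean_space) \<Rightarrow>
     (nat \<Rightarrow> (nat \<Rightarrow> 'x \<times> 'v) \<Rightarrow> 'x \<Rightarrow> 'v) \<Rightarrow> bool" where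
  "omma conf X Y P D n grad C0 \<eta>h pred \<longleftrightarrow>
     (\<forall>t\<in>{1..n}.
        (\<lambda>(past, x). pred t past x) \<in> past_law t D \<Otimes>\<^sub>M X \<rightarrow>\<^sub>M count_space P \<and>
        (\<forall>past\<in>space (past_law t D). \<forall>x\<in>space X.
           is_arg_max
             (\<lambda>yh. grad (omma_confusion conf C0 pred past (t - 1)) \<bullet>
                    expected_confusion conf Y (\<eta>h t past x) yh)
             (\<lambda>yh. yh \<in> P)
             (pred t past x)))"

definition classifier_utility ::
    "('v \<Rightarrow> 'v \<Rightarrow> 'c::real_vector) \<Rightarrow> ('x \<times> 'v) measure \<Rightarrow> nat \<Rightarrow> ('c \<Rightarrow> real) \<Rightarrow>
     ('x \<Rightarrow> 'v) \<Rightarrow> real" where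
  "classifier_utility conf D n \<psi> h =
     (\<integral>z. \<psi> (empirical_confusion conf n (\<lambda>t. snd (z t)) (\<lambda>t. h (fst (z t)))) \<partial>sample_law n D)"

definition online_utility ::
    "('v \<Rightarrow> 'v \<Rightarrow> 'c::real_vector) \<Rightarrow> ('x \<times> 'v) measure \<Rightarrow> nat \<Rightarrow> ('c \<Rightarrow> real) \<Rightarrow>
     (nat \<Rightarrow> (nat \<Rightarrow> 'x \<times> 'v) \<Rightarrow> 'x \<Rightarrow> 'v) \<Rightarrow> real" where
  "online_utility conf D n \<psi> pred =
     (\<integral>z. \<psi> (empirical_confusion conf n (\<lambda>t. snd (z t)) (\<lambda>t. at_trial pred t z)) \<partial>sample_law n D)"

definition optimal_classifier ::
    "('v \<Rightarrow> 'v \<Rightarrow> 'c::real_vector) \<Rightarrow> 'x measure \<Rightarrow> 'v set \<Rightarrow> ('x \<times> 'v) measure \<Rightarrow> nat \<Rightarrow>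
     ('c \<Rightarrow> real) \<Rightarrow> ('x \<Rightarrow> 'v) \<Rightarrow> bool" where
  "optimal_classifier conf X P D n \<psi> h \<longleftrightarrow>
     is_arg_max (classifier_utility conf D n \<psi>) (\<lambda>h. h \<in> X \<rightarrow>\<^sub>M count_space P) h"

definition regret ::
    "('v \<Rightarrow> 'v \<Rightarrow> 'c::real_vector) \<Rightarrow> ('x \<times> 'v) measure \<Rightarrow> nat \<Rightarrow> ('c \<Rightarrow> real) \<Rightarrow>
     ('x \<Rightarrow> 'v) \<Rightarrow> (nat \<Rightarrow> (nat \<Rightarrow> 'x \<times> 'v) \<Rightarrow> 'x \<Rightarrow> 'v) \<Rightarrow> real" where
  "regret conf D n \<psi> hstar pred = classifier_utility conf D n \<psi> hstar - online_utility conf D n \<psi> pred"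

definition estimation_error ::
    "('x \<times> 'v) measure \<Rightarrow> nat \<Rightarrow> ('x \<Rightarrow> 'v) \<Rightarrow>
     (nat \<Rightarrow> (nat \<Rightarrow> 'x \<times> 'v) \<Rightarrow> 'x \<Rightarrow> 'v::euclidean_space) \<Rightarrow> nat \<Rightarrow> real" where
  "estimation_error D n \<eta> \<eta>h t =
     (\<integral>z. norm (\<eta> (fst (z t)) - at_trial \<eta>h t z) \<partial>sample_law n D)"


lemma finite_binary_vectors: "finite (binary_vectors :: (real ^ 'm) set)"
proof -
  have "(binary_vectors :: (real ^ 'm) set) \<subseteq> range (\<lambda>f :: 'm \<Rightarrow> bool. \<chi> j. of_bool (f j))"
  proof
    fix y :: "real ^ 'm" assume "y \<in> binary_vectors"
    then have "y = (\<chi> j. of_bool (y $ j = 1))"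
      by (auto simp: binary_vectors_def vec_eq_iff)
    then show "y \<in> range (\<lambda>f :: 'm \<Rightarrow> bool. \<chi> j. of_bool (f j))"
      by (rule range_eqI[where x = "\<lambda>j. y $ j = 1"])
  qed
  then show ?thesis by (rule finite_subset) simp
qed

lemma pmf_with_mean_exists:
  fixes q :: "'v::euclidean_space"
  assumes fin: "finite Y" and q: "q \<in> convex hull Y"
  shows "\<exists>p. set_pmf p \<subseteq> Y \<and> measure_pmf.expectation p (\<lambda>y. y) = q"
proof -
  obtain u where u: "\<forall>y\<in>Y. 0 \<le> u y" "sum u Y = 1" "(\<Sum>y\<in>Y. u y *\<^sub>R y) = q"
    using q unfolding convex_hull_finite[OF fin] by blast
  define w where "w y = (if y \<in> Y then u y else 0)" for y
  have w0: "\<And>y. 0 \<le> w y" using u by (auto simp: w_def)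
  have "(\<integral>\<^sup>+ y. ennreal (w y) \<partial>count_space UNIV) = (\<Sum>y\<in>Y. ennreal (w y))"
    by (rule nn_integral_count_space'[OF fin]) (auto simp: w_def)
  also have "\<dots> = ennreal (sum w Y)" using w0 by (simp add: sum_ennreal)
  also have "sum w Y = 1" using u by (simp add: w_def cong: sum.cong)
  finally have w1: "(\<integral>\<^sup>+ y. ennreal (w y) \<partial>count_space UNIV) = 1" by simp
  have pm: "pmf (embed_pmf w) y = w y" for y using pmf_embed_pmf[OF w0 w1] .
  have sub: "set_pmf (embed_pmf w) \<subseteq> Y" by (auto simp: set_pmf_iff pm w_def split: if_splits)
  have "measure_pmf.expectation (embed_pmf w) (\<lambda>y. y) = (\<Sum>y\<in>Y. w y *\<^sub>R y)"
    using integral_measure_pmf[OF fin, of "embed_pmf w" "\<lambda>y. y"] sub by (auto simp: pm)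
  also have "\<dots> = q" using u by (simp add: w_def cong: sum.cong)
  finally show ?thesis using sub by blast
qed

lemma expectation_finite_support:
  fixes f :: "'a \<Rightarrow> 'b::{banach, second_countable_topology}"
  assumes "finite Y" "set_pmf p \<subseteq> Y"
  shows "measure_pmf.expectation p f = (\<Sum>y\<in>Y. pmf p y *\<^sub>R f y)"
  using assms by (intro integral_measure_pmf) auto

lemma expectation_multiclass_confusion:
  fixes p :: "(real ^ 'm) pmf"
  assumes "set_pmf p \<subseteq> one_hot_vectors"
  shows "measure_pmf.expectation p (\<lambda>y. multiclass_confusion y yh) =
    (\<chi> j l. measure_pmf.expectation p (\<lambda>y. y) $ j * yh $ l)"
proof -
  have fin: "finite (one_hot_vectors :: (real ^ 'm) set)"
    using finite_binary_vectors by (rule rev_finite_subset) (auto simp: one_hot_vectors_def)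
  show ?thesis
    by (simp add: expectation_finite_support[OF fin assms] vec_eq_iff multiclass_confusion_def
        sum_distrib_right mult.assoc)
qed

lemma expectation_multilabel_confusion:
  fixes p :: "(real ^ 'm) pmf"
  assumes "set_pmf p \<subseteq> binary_vectors"
  shows "measure_pmf.expectation p (\<lambda>y. multilabel_confusion y yh) =
    (\<chi> j u v. (let q = measure_pmf.expectation p (\<lambda>y. y) $ j in if u then q else 1 - q) *
               of_bool (yh $ j = of_bool v))"
proof -
  let ?Y = "binary_vectors :: (real ^ 'm) set"
  note fin = finite_binary_vectors
  have one: "(\<Sum>y\<in>?Y. pmf p y) = 1" using sum_pmf_eq_1[OF fin assms] .
  have entry: "(\<Sum>y\<in>?Y. pmf p y * (of_bool (y $ j = of_bool u) * c)) =
      (let q = (\<Sum>y\<in>?Y. pmf p y * y $ j) in if u then q else 1 - q) * c" for j u and c :: real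
  proof -
    have "(\<Sum>y\<in>?Y. pmf p y * (of_bool (y $ j = of_bool u) * c)) =
        (\<Sum>y\<in>?Y. pmf p y * (if u then y $ j else 1 - y $ j)) * c"
      unfolding sum_distrib_right
    proof (rule sum.cong)
      fix y assume "y \<in> ?Y"
      then have "y $ j = 0 \<or> y $ j = 1" by (auto simp: binary_vectors_def)
      then show "pmf p y * (of_bool (y $ j = of_bool u) * c) =
          pmf p y * (if u then y $ j else 1 - y $ j) * c"
        by (cases u) auto
    qed simp
    then show ?thesis
      using one by (cases u) (simp_all add: right_diff_distrib sum_subtractf)
  qed
  show ?thesis
    by (simp add: expectation_finite_support[OF fin assms] vec_eq_iff multilabel_confusion_def entry)
qed

lemma expected_multiclass_confusion:
  fixes q :: "real ^ 'm"
  assumes "q \<in> convex hull one_hot_vectors"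
  shows "expected_confusion multiclass_confusion one_hot_vectors q yh = (\<chi> j l. q $ j * yh $ l)"
proof -
  have fin: "finite (one_hot_vectors :: (real ^ 'm) set)"
    using finite_binary_vectors by (rule rev_finite_subset) (auto simp: one_hot_vectors_def)
  obtain p where "set_pmf p \<subseteq> one_hot_vectors" "measure_pmf.expectation p (\<lambda>y. y) = q"
    and eq: "expected_confusion multiclass_confusion one_hot_vectors q yh =
      measure_pmf.expectation p (\<lambda>y. multiclass_confusion y yh)"
    using pmf_with_mean_exists[OF fin assms, THEN someI_ex] unfolding expected_confusion_def by blast
  then show ?thesis
    unfolding eq by (simp only: expectation_multiclass_confusion)
qed

lemma expected_multilabel_confusion:
  fixes q :: "real ^ 'm"
  assumes "q \<in> convex hull binary_vectors"
  shows "expected_confusion multilabel_confusion binary_vectors q yh =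
    (\<chi> j u v. (if u then q $ j else 1 - q $ j) * of_bool (yh $ j = of_bool v))"
proof -
  obtain p where "set_pmf p \<subseteq> binary_vectors" "measure_pmf.expectation p (\<lambda>y. y) = q"
    and eq: "expected_confusion multilabel_confusion binary_vectors q yh =
      measure_pmf.expectation p (\<lambda>y. multilabel_confusion y yh)"
    using pmf_with_mean_exists[OF finite_binary_vectors assms, THEN someI_ex]
    unfolding expected_confusion_def by blast
  then show ?thesis
    unfolding eq by (simp only: expectation_multilabel_confusion Let_def)
qed

end

theory Submission
  imports Defs
begin

text \<open>Let \<open>U\<close> be the expected utility of the comparator \<open>h\<close>, \<open>V t\<close> that of \<open>C\<^sub>t\<close>, and put
  \<open>C = C\<^sub>t\<^sub>-\<^sub>1\<close>. Concavity at \<open>C\<close>, integrated over an independent sample, gives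
  \<open>U \<le> \<psi>(C) + \<nabla>\<psi>(C) \<bullet> (C\<^sup>* - C)\<close>, where \<open>C\<^sup>*\<close> is the mean confusion matrix of \<open>h\<close>. Given the
  past, the prediction at trial \<open>t\<close> maximizes \<open>\<nabla>\<psi>(C)\<close> against the estimated label mean, so
  \<open>\<nabla>\<psi>(C) \<bullet> C\<^sup>*\<close> exceeds the conditional mean of \<open>\<nabla>\<psi>(C) \<bullet> c\<^sub>t\<close>, with \<open>c\<^sub>t\<close> the confusion of trial \<open>t\<close>,
  by at most \<open>2 b L\<close> times the estimation error \<open>\<epsilon>\<^sub>t\<close>. Since \<open>C\<^sub>t - C = (c\<^sub>t - C) / t\<close> and
  \<open>c\<^sub>t - C\<close> has squared norm at most \<open>2 a\<close>, smoothness yields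
  \<open>t (U - V t) \<le> (t - 1) (U - V (t - 1)) + 2 b L \<epsilon>\<^sub>t + M a / t\<close>, and the sum telescopes.\<close>

section \<open>Geometry of the achievable confusion matrices\<close>

text \<open>Averages over finitely many trials realise only rational weights, so \<open>S\<close>
  itself need not be convex. The weight is a quotient of naturals because it comes from counting
  trials; for \<open>N = 0\<close> it is \<open>0\<close> by the convention for division, and the
  condition is trivial.\<close>

definition rationally_convex :: "'c::real_vector set \<Rightarrow> bool" where
  "rationally_convex S \<longleftrightarrow>
     (\<forall>A\<in>S. \<forall>B\<in>S. \<forall>i N. i \<le> N \<longrightarrow> A + (real i / real N) *\<^sub>R (B - A) \<in> S)"

lemma rationally_convexD:
  "rationally_convex S \<Longrightarrow> A \<in> S \<Longrightarrow> B \<in> S \<Longrightarrow> i \<le> N \<Longrightarrow>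
    A + (real i / real N) *\<^sub>R (B - A) \<in> S"
  by (auto simp: rationally_convex_def)

text \<open>Supplies rational weights with denominator \<open>k\<close> for a real weight
  \<open>u\<close>: rounding down loses less than \<open>1 / k\<close>.\<close>

lemma nat_floor_mult_over_tendsto:
  assumes "0 \<le> u"
  shows "(\<lambda>k. real (nat \<lfloor>u * real k\<rfloor>) / real k) \<longlonglongrightarrow> u"
proof (rule tendsto_sandwich)
  show "\<forall>\<^sub>F k in sequentially. u - 1 / real k \<le> real (nat \<lfloor>u * real k\<rfloor>) / real k"
    using eventually_gt_at_top[of 0]
  proof eventually_elim
    case (elim k)
    have "u * real k - 1 \<le> real (nat \<lfloor>u * real k\<rfloor>)" by linarith
    then have "(u * real k - 1) / real k \<le> real (nat \<lfloor>u * real k\<rfloor>) / real k"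
      by (rule divide_right_mono) simp
    then show ?case using elim by (simp add: diff_divide_distrib)
  qed
  show "\<forall>\<^sub>F k in sequentially. real (nat \<lfloor>u * real k\<rfloor>) / real k \<le> u"
    using eventually_gt_at_top[of 0]
  proof eventually_elim
    case (elim k)
    have "real (nat \<lfloor>u * real k\<rfloor>) \<le> u * real k" using assms by simp
    then show ?case using elim by (simp add: field_simps)
  qed
  have "(\<lambda>k. u - 1 / real k) \<longlonglongrightarrow> u - 0"
    by (intro tendsto_diff tendsto_const lim_1_over_n)
  then show "(\<lambda>k. u - 1 / real k) \<longlonglongrightarrow> u" by simp
qed simp

text \<open>Approximating the endpoints by points of \<open>S\<close> and the weight by fractions
  keeps the combinations in \<open>S\<close>, and they converge to the given one.\<close>

lemma convex_closure_rationally_convex: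
  fixes S :: "'c::real_normed_vector set"
  assumes S: "rationally_convex S"
  shows "convex (closure S)"
proof (rule convexI)
  fix x y :: 'c and u v :: real
  assume x: "x \<in> closure S" and y: "y \<in> closure S" and uv: "0 \<le> u" "0 \<le> v" "u + v = 1"
  obtain xs where xs: "\<And>k. xs k \<in> S" "xs \<longlonglongrightarrow> x" using x unfolding closure_sequential by blast
  obtain ys where ys: "\<And>k. ys k \<in> S" "ys \<longlonglongrightarrow> y" using y unfolding closure_sequential by blast
  define r where "r k = real (nat \<lfloor>v * real k\<rfloor>) / real k" for k
  have "nat \<lfloor>v * real k\<rfloor> \<le> k" for k
  proof -
    have "v * real k \<le> 1 * real k" using uv by (intro mult_right_mono) auto
    then show ?thesis by linarith
  qed
  then have in_S: "xs k + r k *\<^sub>R (ys k - xs k) \<in> S" for k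
    unfolding r_def using rationally_convexD[OF S] xs ys by blast
  have "r \<longlonglongrightarrow> v" unfolding r_def using nat_floor_mult_over_tendsto uv by simp
  then have "(\<lambda>k. xs k + r k *\<^sub>R (ys k - xs k)) \<longlonglongrightarrow> x + v *\<^sub>R (y - x)"
    using xs ys by (intro tendsto_intros)
  then have "x + v *\<^sub>R (y - x) \<in> closure S"
    unfolding closure_sequential using in_S by (intro exI conjI allI)
  moreover have "u = 1 - v" using uv by simp
  then have "x + v *\<^sub>R (y - x) = u *\<^sub>R x + v *\<^sub>R y"
    by (simp add: scaleR_diff_left scaleR_diff_right)
  ultimately show "u *\<^sub>R x + v *\<^sub>R y \<in> closure S" by simp
qed

section \<open>Achievable matrices as averages over multisets of label-prediction pairs\<close>

lemma sum_mset_image_repeat_mset: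
  fixes f :: "'a \<Rightarrow> 'c::real_vector"
  shows "sum_mset (image_mset f (repeat_mset k M)) = real k *\<^sub>R sum_mset (image_mset f M)"
  by (induction k) (simp_all add: scaleR_add_left)

lemma set_mset_repeat_mset_subset: "set_mset (repeat_mset k M) \<subseteq> set_mset M"
  by (induction k) auto

text \<open>The order of the trials does not affect the average, and multisets can be repeated and
  added directly. Clearing the denominator turns the average into an additive identity.\<close>

lemma achievable_confusions_iff_mset:
  "C \<in> achievable_confusions conf Y P \<longleftrightarrow>
     (\<exists>W. W \<noteq> {#} \<and> set_mset W \<subseteq> Y \<times> P \<and>
       real (size W) *\<^sub>R C = sum_mset (image_mset (\<lambda>(y, p). conf y p) W))"
proof
  assume "C \<in> achievable_confusions conf Y P"
  then obtain t y yh where t: "t \<ge> 1" and yh: "\<forall>s\<in>{1..t}. y s \<in> Y \<and> yh s \<in> P"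
    and C: "C = empirical_confusion conf t y yh"
    unfolding achievable_confusions_def by blast
  define W where "W = image_mset (\<lambda>s. (y s, yh s)) (mset_set {1..t})"
  have "sum_mset (image_mset (\<lambda>(y, p). conf y p) W) = (\<Sum>s = 1..t. conf (y s) (yh s))"
    by (simp add: W_def image_mset.compositionality comp_def sum_unfold_sum_mset)
  moreover have "size W = t" by (simp add: W_def)
  ultimately have "real (size W) *\<^sub>R C = sum_mset (image_mset (\<lambda>(y, p). conf y p) W)"
    using t by (simp add: C empirical_confusion_def)
  moreover have "W \<noteq> {#}" using \<open>size W = t\<close> t by auto
  moreover have "set_mset W \<subseteq> Y \<times> P" using yh by (auto simp: W_def)
  ultimately show "\<exists>W. W \<noteq> {#} \<and> set_mset W \<subseteq> Y \<times> P \<and>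
      real (size W) *\<^sub>R C = sum_mset (image_mset (\<lambda>(y, p). conf y p) W)" by blast
next
  assume "\<exists>W. W \<noteq> {#} \<and> set_mset W \<subseteq> Y \<times> P \<and>
      real (size W) *\<^sub>R C = sum_mset (image_mset (\<lambda>(y, p). conf y p) W)"
  then obtain W where W: "W \<noteq> {#}" "set_mset W \<subseteq> Y \<times> P"
    and C: "real (size W) *\<^sub>R C = sum_mset (image_mset (\<lambda>(y, p). conf y p) W)" by blast
  obtain xs where xs: "mset xs = W" using ex_mset by blast
  define t where "t = length xs"
  have t: "t \<ge> 1" "size W = t" using W xs by (auto simp: t_def Suc_le_eq)
  define y yh where "y s = fst (xs ! (s - 1))" and "yh s = snd (xs ! (s - 1))" for s
  have "sum_mset (image_mset (\<lambda>(y, p). conf y p) W) = sum_list (map (\<lambda>(y, p). conf y p) xs)"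
    unfolding xs[symmetric] by (simp flip: sum_mset_sum_list)
  also have "\<dots> = (\<Sum>i = 0..<t. (\<lambda>(y, p). conf y p) (xs ! i))"
    by (simp add: sum_list_sum_nth t_def)
  also have "\<dots> = (\<Sum>s = 1..t. conf (y s) (yh s))"
    by (rule sum.reindex_bij_witness[of _ "\<lambda>s. s - 1" Suc])
      (auto simp: y_def yh_def split_beta)
  finally have sum: "real t *\<^sub>R C = (\<Sum>s = 1..t. conf (y s) (yh s))"
    using t C by simp
  have "C = empirical_confusion conf t y yh"
    unfolding empirical_confusion_def sum[symmetric] using t by simp
  moreover have "y s \<in> Y \<and> yh s \<in> P" if "s \<in> {1..t}" for s
  proof -
    have "xs ! (s - 1) \<in> set xs" using that by (auto simp: t_def)
    then have "xs ! (s - 1) \<in> Y \<times> P" using W xs by auto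
    then show ?thesis by (auto simp: y_def yh_def)
  qed
  ultimately show "C \<in> achievable_confusions conf Y P"
    unfolding achievable_confusions_def using t by blast
qed

lemma rationally_convex_achievable_confusions:
  "rationally_convex (achievable_confusions conf Y P)"
  unfolding rationally_convex_def
proof (intro ballI allI impI)
  fix A B and i N :: nat
  assume A: "A \<in> achievable_confusions conf Y P" and B: "B \<in> achievable_confusions conf Y P"
    and iN: "i \<le> N"
  show "A + (real i / real N) *\<^sub>R (B - A) \<in> achievable_confusions conf Y P"
  proof (cases "N = 0")
    case True then show ?thesis using A by simp
  next
    case False
    obtain V where V: "V \<noteq> {#}" "set_mset V \<subseteq> Y \<times> P"
      "real (size V) *\<^sub>R A = sum_mset (image_mset (\<lambda>(y, p). conf y p) V)"
      using A unfolding achievable_confusions_iff_mset by blast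
    obtain W where W: "W \<noteq> {#}" "set_mset W \<subseteq> Y \<times> P"
      "real (size W) *\<^sub>R B = sum_mset (image_mset (\<lambda>(y, p). conf y p) W)"
      using B unfolding achievable_confusions_iff_mset by blast
    \<comment> \<open>The factors \<open>size W\<close> and \<open>size V\<close> bring both samples
      to a common size; \<open>N - i\<close> parts of the first and \<open>i\<close> parts of the
      second then give \<open>A\<close> and \<open>B\<close> the weights \<open>1 - i / N\<close>
      and \<open>i / N\<close>.\<close>
    define U where "U = repeat_mset ((N - i) * size W) V + repeat_mset (i * size V) W"
    obtain k where k: "N = i + k" using iN le_Suc_ex by blast
    have size: "size U = N * size V * size W" by (simp add: U_def k add_mult_distrib mult.assoc mult.left_commute)
    have "sum_mset (image_mset (\<lambda>(y, p). conf y p) U) =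
        (real (N - i) * size W * size V) *\<^sub>R A + (real i * size V * size W) *\<^sub>R B"
      by (simp add: U_def sum_mset_image_repeat_mset flip: V(3) W(3))
    also have "\<dots> = real (size U) *\<^sub>R (A + (real i / real N) *\<^sub>R (B - A))"
    proof -
      have "real (size U) * (real i / real N) = real i * size V * size W"
        using False by (simp add: size)
      then have "real (size U) *\<^sub>R (A + (real i / real N) *\<^sub>R (B - A)) =
          real (size U) *\<^sub>R A + (real i * size V * size W) *\<^sub>R (B - A)"
        by (simp only: scaleR_add_right scaleR_scaleR)
      also have "\<dots> = (real (size U) - real i * size V * size W) *\<^sub>R A
          + (real i * size V * size W) *\<^sub>R B"
        by (simp add: scaleR_diff_right scaleR_diff_left)
      also have "real (size U) - real i * size V * size W = real (N - i) * size W * size V"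
        by (simp add: size k algebra_simps)
      finally show ?thesis by (rule sym)
    qed
    finally have "real (size U) *\<^sub>R (A + (real i / real N) *\<^sub>R (B - A)) =
        sum_mset (image_mset (\<lambda>(y, p). conf y p) U)" ..
    moreover have "size U \<noteq> 0" using False V W by (simp add: size)
    then have "U \<noteq> {#}" by auto
    moreover have "set_mset U \<subseteq> Y \<times> P"
      using V(2) W(2) set_mset_repeat_mset_subset[of _ V] set_mset_repeat_mset_subset[of _ W]
      unfolding U_def set_mset_union by blast
    ultimately show ?thesis unfolding achievable_confusions_iff_mset by blast
  qed
qed

lemma achievable_confusions_single:
  assumes "y \<in> Y" "p \<in> P"
  shows "conf y p \<in> achievable_confusions conf Y P"
  unfolding achievable_confusions_iff_mset using assms
  by (intro exI[of _ "{#(y, p)#}"]) simp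

text \<open>Places mixtures with irrational weights, such as expected confusion matrices, in the
  closure of \<open>S\<close>, where the gradient bound below applies.\<close>

lemma convex_hull_subset_closure_achievable:
  fixes conf :: "'v \<Rightarrow> 'v \<Rightarrow> 'c::real_normed_vector"
  shows "convex hull (\<Union>y\<in>Y. conf y ` P) \<subseteq> closure (achievable_confusions conf Y P)"
  using achievable_confusions_single[of _ Y _ P conf] closure_subset
  by (intro hull_minimal convex_closure_rationally_convex rationally_convex_achievable_confusions)
    blast

text \<open>Each achievable matrix is a uniform average of single-trial matrices, so a convex bound
  checked on these extends to all of \<open>S\<close>.\<close>

lemma achievable_confusions_subset_convex_hull:
  "achievable_confusions conf Y P \<subseteq> convex hull (\<Union>y\<in>Y. conf y ` P)"
proof
  fix C assume "C \<in> achievable_confusions conf Y P"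
  then obtain t y yh where t: "t \<ge> 1" and yh: "\<forall>s\<in>{1..t}. y s \<in> Y \<and> yh s \<in> P"
    and C: "C = empirical_confusion conf t y yh"
    unfolding achievable_confusions_def by blast
  have "(\<Sum>s = 1..t. (1 / real t) *\<^sub>R conf (y s) (yh s)) \<in> convex hull (\<Union>y\<in>Y. conf y ` P)"
    using t yh by (intro convex_sum convex_convex_hull hull_inc UN_I imageI) auto
  then show "C \<in> convex hull (\<Union>y\<in>Y. conf y ` P)"
    by (simp add: C empirical_confusion_def scaleR_sum_right)
qed

text \<open>The Lipschitz condition holds on \<open>S\<close> only, so a difference quotient at \<open>C\<close> is available only
  in directions pointing into \<open>S\<close>. Comparing the two nearby points \<open>C + (A - C) / N\<close> and
  \<open>C + (B - C) / N\<close> instead gives the bound for every direction \<open>A - B\<close>.\<close>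

lemma concave_smooth_utility_gradient_bound:
  assumes S: "rationally_convex S" and \<psi>: "concave_smooth_utility S \<psi> g L M"
    and C: "C \<in> S" and A: "A \<in> closure S" and B: "B \<in> closure S"
  shows "g C \<bullet> (A - B) \<le> L * norm (A - B)"
proof -
  have in_S: "g C \<bullet> (A - B) \<le> L * norm (A - B)" if A: "A \<in> S" and B: "B \<in> S" for A B
  proof -
    define a b where "a N = C + (real 1 / real (Suc N)) *\<^sub>R (A - C)"
      and "b N = C + (real 1 / real (Suc N)) *\<^sub>R (B - C)" for N
    have ab: "a N \<in> S" "b N \<in> S" for N
      unfolding a_def b_def by (intro rationally_convexD[OF S C] A B; simp)+
    have diff: "a N - b N = (1 / real (Suc N)) *\<^sub>R (A - B)" for N
      by (simp add: a_def b_def scaleR_diff_right)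
    have "g (a N) \<bullet> (A - B) \<le> L * norm (A - B)" for N
    proof -
      \<comment> \<open>Concavity is linearised at \<open>a N\<close> and not at \<open>C\<close>,
        so that the difference of the two nearby points appears as the direction.\<close>
      have "\<psi> (b N) \<le> \<psi> (a N) + g (a N) \<bullet> (b N - a N)"
        using \<psi> ab by (auto simp: concave_smooth_utility_def)
      moreover have "\<psi> (a N) - \<psi> (b N) \<le> L * norm (a N - b N)"
        using \<psi> ab lipschitz_onD[of L S \<psi> "a N" "b N"]
        by (auto simp: concave_smooth_utility_def dist_norm)
      ultimately have "g (a N) \<bullet> (a N - b N) \<le> L * norm (a N - b N)"
        by (simp add: inner_diff_right)
      then have "(1 / real (Suc N)) * (g (a N) \<bullet> (A - B)) \<le> (1 / real (Suc N)) * (L * norm (A - B))"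
        unfolding diff by simp
      then show ?thesis by (rule mult_left_le_imp_le) simp
    qed
    \<comment> \<open>The gradient is continuous on \<open>S\<close>, being
      \<open>M\<close>-Lipschitz there; this carries the bound from \<open>a N\<close> back to
      \<open>C\<close>.\<close>
    moreover have "(\<lambda>N. g (a N)) \<longlonglongrightarrow> g C"
    proof -
      have "(\<lambda>N. C + inverse (real (Suc N)) *\<^sub>R (A - C)) \<longlonglongrightarrow> C + 0 *\<^sub>R (A - C)"
        by (intro tendsto_intros LIMSEQ_inverse_real_of_nat)
      then have "a \<longlonglongrightarrow> C" by (simp add: a_def[abs_def] inverse_eq_divide)
      moreover have "continuous_on S g"
        using \<psi> lipschitz_on_continuous_on by (auto simp: concave_smooth_utility_def)
      ultimately show ?thesis
        using continuous_on_tendsto_compose[of S g a C sequentially] C ab by simp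
    qed
    then have "(\<lambda>N. g (a N) \<bullet> (A - B)) \<longlonglongrightarrow> g C \<bullet> (A - B)" by (intro tendsto_intros)
    ultimately show ?thesis by (intro LIMSEQ_le_const2) auto
  qed
  obtain as where as: "\<And>k. as k \<in> S" "as \<longlonglongrightarrow> A" using A unfolding closure_sequential by blast
  obtain bs where bs: "\<And>k. bs k \<in> S" "bs \<longlonglongrightarrow> B" using B unfolding closure_sequential by blast
  show ?thesis
  proof (rule LIMSEQ_le)
    show "(\<lambda>k. g C \<bullet> (as k - bs k)) \<longlonglongrightarrow> g C \<bullet> (A - B)"
      using as bs by (intro tendsto_intros)
    show "(\<lambda>k. L * norm (as k - bs k)) \<longlonglongrightarrow> L * norm (A - B)"
      using as bs by (intro tendsto_intros)
    show "\<exists>N. \<forall>k\<ge>N. g C \<bullet> (as k - bs k) \<le> L * norm (as k - bs k)"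
      using in_S as bs by blast
  qed
qed

text \<open>Concavity is applied along \<open>N\<close> equal steps from \<open>C\<close> to \<open>C'\<close>; a single step would only give
  the constant \<open>M\<close> instead of \<open>M / 2\<close>.\<close>

lemma concave_smooth_utility_lower_bound:
  assumes S: "rationally_convex S" and \<psi>: "concave_smooth_utility S \<psi> g L M"
    and C: "C \<in> S" and C': "C' \<in> S"
  shows "\<psi> C + g C \<bullet> (C' - C) - M / 2 * (norm (C' - C))\<^sup>2 \<le> \<psi> C'"
proof -
  define D where "D = C' - C"
  define p where "p N i = C + (real i / real N) *\<^sub>R D" for N i
  have p: "p N i \<in> S" if "i \<le> N" for N i
    using that unfolding p_def D_def by (intro rationally_convexD[OF S C C'])
  \<comment> \<open>Concavity at the later point \<open>p N (Suc i)\<close> bounds the increment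
    below by the gradient there, which differs from \<open>g C\<close> by at most \<open>M\<close>
    times the distance \<open>(i + 1) / N * norm D\<close> from \<open>C\<close>.\<close>
  have step: "(1 / real N) * (g C \<bullet> D) - M * real (Suc i) / (real N)\<^sup>2 * (norm D)\<^sup>2
      \<le> \<psi> (p N (Suc i)) - \<psi> (p N i)" if i: "Suc i \<le> N" for N i
  proof -
    have pS: "p N i \<in> S" "p N (Suc i) \<in> S" using i by (auto intro: p)
    have N: "real N > 0" using i by simp
    have d: "p N i - p N (Suc i) = - ((1 / real N) *\<^sub>R D)"
      by (simp add: p_def add_divide_distrib scaleR_add_left)
    have "\<psi> (p N i) \<le> \<psi> (p N (Suc i)) + g (p N (Suc i)) \<bullet> (p N i - p N (Suc i))"
      using \<psi> pS by (auto simp: concave_smooth_utility_def)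
    then have 1: "(1 / real N) * (g (p N (Suc i)) \<bullet> D) \<le> \<psi> (p N (Suc i)) - \<psi> (p N i)"
      by (simp add: d)
    have "norm (g (p N (Suc i)) - g C) \<le> M * norm (p N (Suc i) - C)"
      using \<psi> pS C lipschitz_onD[of M S g "p N (Suc i)" C]
      by (auto simp: concave_smooth_utility_def dist_norm)
    also have "\<dots> = M * (real (Suc i) / real N * norm D)" by (simp add: p_def)
    finally have 2: "norm (g (p N (Suc i)) - g C) \<le> M * (real (Suc i) / real N * norm D)" .
    have "(g C - g (p N (Suc i))) \<bullet> D \<le> norm (g (p N (Suc i)) - g C) * norm D"
      using norm_cauchy_schwarz[of "g C - g (p N (Suc i))" D] by (simp add: norm_minus_commute)
    also have "\<dots> \<le> M * (real (Suc i) / real N * norm D) * norm D"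
      by (intro mult_right_mono 2) simp
    finally have "g C \<bullet> D - M * (real (Suc i) / real N * norm D) * norm D \<le> g (p N (Suc i)) \<bullet> D"
      by (simp add: inner_diff_left)
    then have "(1 / real N) * (g C \<bullet> D - M * (real (Suc i) / real N * norm D) * norm D)
        \<le> (1 / real N) * (g (p N (Suc i)) \<bullet> D)"
      by (intro mult_left_mono) auto
    moreover have "(1 / real N) * (g C \<bullet> D - M * (real (Suc i) / real N * norm D) * norm D)
       = (1 / real N) * (g C \<bullet> D) - M * real (Suc i) / (real N)\<^sup>2 * (norm D)\<^sup>2"
      using N by (simp add: power2_eq_square right_diff_distrib)
    ultimately show ?thesis using 1 by linarith
  qed
  have bound: "\<psi> C + g C \<bullet> D - M * (1 + 1 / real N) / 2 * (norm D)\<^sup>2 \<le> \<psi> C'" if N: "N > 0" for N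
  proof -
    \<comment> \<open>The errors of the steps add up to
      \<open>(1 + ... + N) / N^2 = (1 + 1 / N) / 2\<close>, which tends to the factor
      \<open>1 / 2\<close>.\<close>
    have sum_Suc: "(\<Sum>i<N. real (Suc i)) = real N * (real N + 1) / 2"
      by (induction N) (auto simp: field_simps)
    have "(\<Sum>i<N. (1 / real N) * (g C \<bullet> D) - M * real (Suc i) / (real N)\<^sup>2 * (norm D)\<^sup>2)
        \<le> (\<Sum>i<N. \<psi> (p N (Suc i)) - \<psi> (p N i))"
      by (intro sum_mono step) simp
    also have "\<dots> = \<psi> (p N N) - \<psi> (p N 0)" by (rule sum_lessThan_telescope)
    also have "\<dots> = \<psi> C' - \<psi> C" using N by (simp add: p_def D_def)
    also have "(\<Sum>i<N. (1 / real N) * (g C \<bullet> D) - M * real (Suc i) / (real N)\<^sup>2 * (norm D)\<^sup>2)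
        = g C \<bullet> D - M / (real N)\<^sup>2 * (norm D)\<^sup>2 * (\<Sum>i<N. real (Suc i))"
      using N by (simp add: sum_subtractf sum_distrib_left sum_divide_distrib mult_ac del: of_nat_Suc)
    also have "\<dots> = g C \<bullet> D - M * (1 + 1 / real N) / 2 * (norm D)\<^sup>2"
      unfolding sum_Suc using N by (simp add: power2_eq_square field_simps)
    finally show ?thesis by simp
  qed
  have "(\<lambda>N. \<psi> C + g C \<bullet> D - M * (1 + 1 / real N) / 2 * (norm D)\<^sup>2)
      \<longlonglongrightarrow> \<psi> C + g C \<bullet> D - M * (1 + 0) / 2 * (norm D)\<^sup>2"
    by (intro tendsto_intros lim_1_over_n) auto
  then have "\<psi> C + g C \<bullet> D - M * (1 + 0) / 2 * (norm D)\<^sup>2 \<le> \<psi> C'"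
    by (rule LIMSEQ_le_const2) (use bound in \<open>auto intro!: exI[of _ 1]\<close>)
  then show ?thesis by (simp add: D_def)
qed

section \<open>Plug-in decisions\<close>

lemma simple_function_count_space:
  assumes f: "f \<in> M \<rightarrow>\<^sub>M count_space A" and "finite A"
  shows "simple_function M f"
  unfolding simple_function_def
proof
  show "finite (f ` space M)"
    using measurable_space[OF f] \<open>finite A\<close> by (auto intro: finite_subset[of _ A])
  show "\<forall>x\<in>f ` space M. f -` {x} \<inter> space M \<in> sets M"
    using measurable_space[OF f] by (auto intro!: measurable_sets[OF f])
qed

text \<open>The finite range gives a bound. Labels and predictions take finitely many values, so
  utilities and gradients of confusion matrices are simple functions of the sample, and
  integrability comes from composition alone.\<close>

lemma (in finite_measure) integrable_simple_function:
  fixes f :: "'a \<Rightarrow> 'b::{banach, second_countable_topology}"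
  assumes "simple_function M f"
  shows "integrable M f"
proof (rule integrable_const_bound)
  have "finite (norm ` f ` space M)" using assms by (simp add: simple_function_def)
  then show "AE x in M. norm (f x) \<le> Max (norm ` f ` space M)"
    by (intro AE_I2 Max_ge) auto
  show "f \<in> borel_measurable M" by (rule borel_measurable_simple_function[OF assms])
qed

text \<open>The difference \<open>harm n - ln n\<close> decreases and equals 1 at
  \<open>n = 1\<close>.\<close>

lemma harm_le_one_plus_ln:
  assumes "n \<ge> 1"
  shows "harm n \<le> 1 + ln (real n)"
proof -
  obtain k where k: "n = Suc k" using assms by (cases n) auto
  have "harm (Suc k) - ln (real (Suc k)) \<le> harm (Suc 0) - ln (real (Suc 0))"
    using decseqD[OF decseq_harm_diff_ln, of 0 k] by simp
  then show ?thesis by (simp add: k harm_expand)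
qed

text \<open>\<open>K\<close> is the extension of \<open>conf\<close> to arbitrary label means that is affine in its first argument.\<close>

locale affine_confusion =
  fixes conf K :: "real ^ 'm \<Rightarrow> real ^ 'm \<Rightarrow> 'c::euclidean_space"
    and Y P :: "(real ^ 'm) set" and a b :: real
  assumes finite_Y: "finite Y" and finite_P: "finite P"
    and linear_K: "linear (\<lambda>q. K q p - K 0 p)"
    and K_eq_conf: "\<lbrakk>y \<in> Y; p \<in> P\<rbrakk> \<Longrightarrow> K y p = conf y p"
    and expected_confusion_eq:
      "\<lbrakk>q \<in> convex hull Y; p \<in> P\<rbrakk> \<Longrightarrow> expected_confusion conf Y q p = K q p"
    and norm_K_diff: "p \<in> P \<Longrightarrow> norm (K q p - K r p) \<le> b * norm (q - r)"
    and norm_conf_diff: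
      "\<lbrakk>y \<in> Y; y' \<in> Y; p \<in> P; p' \<in> P\<rbrakk> \<Longrightarrow> (norm (conf y p - conf y' p'))\<^sup>2 \<le> 2 * a"
begin

abbreviation "S \<equiv> achievable_confusions conf Y P"

text \<open>An affine map is determined by its values at the origin and the unit vectors. This
  separates the label coordinates from factors that depend on the prediction only.\<close>

lemma K_expand: "K q p = K 0 p + (\<Sum>j\<in>UNIV. q $ j *\<^sub>R (K (axis j 1) p - K 0 p))"
proof -
  have "K q p - K 0 p = (\<lambda>q. K q p - K 0 p) (\<Sum>j\<in>UNIV. q $ j *\<^sub>R axis j 1)"
    using basis_expansion[of q] by (simp add: scalar_mult_eq_scaleR)
  also have "\<dots> = (\<Sum>j\<in>UNIV. q $ j *\<^sub>R (K (axis j 1) p - K 0 p))"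
    by (subst linear_sum[OF linear_K]) (simp add: linear_scale[OF linear_K])
  finally show ?thesis by (simp add: algebra_simps)
qed

text \<open>The preimage of a convex set under the affine map \<open>K _ p\<close> is convex, and
  here it contains \<open>Y\<close>.\<close>

lemma K_in_closure:
  assumes q: "q \<in> convex hull Y" and p: "p \<in> P"
  shows "K q p \<in> closure S"
proof -
  let ?H = "convex hull (\<Union>y\<in>Y. conf y ` P)"
  have "convex {q. K q p \<in> ?H}"
  proof (rule convexI)
    fix q r and u v :: real
    assume qr: "q \<in> {q. K q p \<in> ?H}" "r \<in> {q. K q p \<in> ?H}" and uv: "0 \<le> u" "0 \<le> v" "u + v = 1"
    have "K (u *\<^sub>R q + v *\<^sub>R r) p - K 0 p = u *\<^sub>R (K q p - K 0 p) + v *\<^sub>R (K r p - K 0 p)"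
      using linear_add[OF linear_K[of p], of "u *\<^sub>R q" "v *\<^sub>R r"]
      by (simp add: linear_scale[OF linear_K[of p]])
    also have "\<dots> = u *\<^sub>R K q p + v *\<^sub>R K r p - (u + v) *\<^sub>R K 0 p"
      by (simp add: algebra_simps)
    finally have "K (u *\<^sub>R q + v *\<^sub>R r) p = u *\<^sub>R K q p + v *\<^sub>R K r p"
      using uv by simp
    then show "u *\<^sub>R q + v *\<^sub>R r \<in> {q. K q p \<in> ?H}"
      using convexD[OF convex_convex_hull] qr uv by fastforce
  qed
  moreover have "Y \<subseteq> {q. K q p \<in> ?H}"
    using p by (auto simp: K_eq_conf intro!: hull_inc)
  ultimately have "convex hull Y \<subseteq> {q. K q p \<in> ?H}" by (rule hull_minimal[rotated])
  then show ?thesis using q convex_hull_subset_closure_achievable by fastforce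
qed

text \<open>A ball around \<open>conf y p\<close> of radius \<open>sqrt (2 * a)\<close> contains all
  single-trial matrices, hence by convexity their averages.\<close>

lemma norm_conf_minus_achievable:
  assumes "y \<in> Y" "p \<in> P" "C \<in> S"
  shows "(norm (conf y p - C))\<^sup>2 \<le> 2 * a"
proof -
  have "(\<Union>y\<in>Y. conf y ` P) \<subseteq> cball (conf y p) (sqrt (2 * a))"
    using norm_conf_diff assms by (auto simp: dist_norm intro!: real_le_rsqrt)
  then have "convex hull (\<Union>y\<in>Y. conf y ` P) \<subseteq> cball (conf y p) (sqrt (2 * a))"
    by (rule hull_minimal) (rule convex_cball)
  then have "norm (conf y p - C) \<le> sqrt (2 * a)"
    using achievable_confusions_subset_convex_hull[of conf Y P] assms by (auto simp: dist_norm)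
  moreover have "0 \<le> 2 * a" using norm_conf_diff[of y y p p] assms by simp
  ultimately show ?thesis by (simp add: sqrt_ge_absD)
qed

end

section \<open>Conditional label means and the expected confusion of a classifier\<close>

locale label_model = affine_confusion conf K Y P a b
  for conf K :: "real ^ 'm \<Rightarrow> real ^ 'm \<Rightarrow> 'c::euclidean_space" and Y P a b +
  fixes X :: "'x measure" and D :: "('x \<times> (real ^ 'm)) measure" and \<eta> :: "'x \<Rightarrow> real ^ 'm"
  assumes data: "data_distribution X Y D" and label_mean: "conditional_label_mean X D \<eta>"
begin

sublocale D: prob_space D using data by (simp add: data_distribution_def)

lemma sets_D [measurable_cong]: "sets D = sets (X \<Otimes>\<^sub>M count_space Y)"
  using data by (simp add: data_distribution_def)

lemma space_D: "space D = space X \<times> Y"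
  using sets_eq_imp_space_eq[OF sets_D] by (simp add: space_pair_measure)

lemma measurable_fst_D [measurable]: "fst \<in> D \<rightarrow>\<^sub>M X"
  by measurable

lemma measurable_snd_D: "snd \<in> D \<rightarrow>\<^sub>M count_space Y"
  by measurable

lemma borel_measurable_eta [measurable]: "\<eta> \<in> borel_measurable X"
  using label_mean by (simp add: conditional_label_mean_def)

lemma borel_measurable_eta_component [measurable]: "(\<lambda>x. \<eta> x $ j) \<in> borel_measurable X"
  unfolding cart_eq_inner_axis by measurable

lemma integrable_label: "integrable D (\<lambda>z. snd z $ j)"
  by (rule D.integrable_simple_function)
    (rule simple_function_compose1[OF simple_function_count_space[OF measurable_snd_D finite_Y]])

abbreviation "F \<equiv> vimage_algebra (space D) fst X"

sublocale cond: finite_measure_subalgebra D F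
proof unfold_locales
  show "subalgebra D F"
    unfolding subalgebra_def
    using measurable_space[OF measurable_fst_D]
    by (subst sets_vimage_algebra2) (auto intro: measurable_sets[OF measurable_fst_D])
qed

lemma measurable_F: "h \<in> borel_measurable X \<Longrightarrow> (\<lambda>z. h (fst z)) \<in> borel_measurable F"
  by (rule measurable_compose[OF measurable_vimage_algebra1]) (auto simp: space_D)

lemma eta_eq_cond_exp:
  "AE z in D. \<eta> (fst z) $ j = real_cond_exp D F (\<lambda>z. snd z $ j) z"
  using label_mean by (simp add: conditional_label_mean_def)

text \<open>The hull of a finite set is a finite intersection of half-spaces. A linear inequality
  valid on \<open>Y\<close> passes to the conditional expectation almost surely, and finitely many
  null sets may be combined.\<close>

lemma eta_in_convex_hull: "AE z in D. \<eta> (fst z) \<in> convex hull Y"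
proof -
  obtain H where H: "finite H" "convex hull Y = \<Inter> H"
    "\<forall>h\<in>H. \<exists>v \<beta>. v \<noteq> 0 \<and> h = {x. v \<bullet> x \<le> \<beta>}"
    using polytope_imp_polyhedron[OF polytope_convex_hull[OF finite_Y]]
    unfolding polyhedron_def by blast
  have "AE z in D. \<eta> (fst z) \<in> h" if h: "h \<in> H" for h
  proof -
    obtain v \<beta> where v: "h = {x. v \<bullet> x \<le> \<beta>}" using H h by blast
    have Y: "v \<bullet> y \<le> \<beta>" if "y \<in> Y" for y
      using that h H v hull_inc[of y Y convex] by blast
    have "AE z in D. real_cond_exp D F (\<lambda>z. \<Sum>j\<in>UNIV. v $ j * snd z $ j) z \<le> \<beta>"
      using Y by (intro cond.real_cond_exp_le_c Bochner_Integration.integrable_sum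
          integrable_mult_right integrable_label AE_I2) (auto simp: space_D inner_vec_def)
    moreover have "AE z in D. real_cond_exp D F (\<lambda>z. \<Sum>j\<in>UNIV. v $ j * snd z $ j) z =
        (\<Sum>j\<in>UNIV. real_cond_exp D F (\<lambda>z. v $ j * snd z $ j) z)"
      by (intro cond.real_cond_exp_sum integrable_mult_right integrable_label)
    moreover have "AE z in D. \<forall>j\<in>UNIV.
        real_cond_exp D F (\<lambda>z. v $ j * snd z $ j) z = v $ j * real_cond_exp D F (\<lambda>z. snd z $ j) z"
      by (intro AE_finite_allI cond.real_cond_exp_cmult integrable_label) simp
    moreover have "AE z in D. \<forall>j\<in>UNIV. \<eta> (fst z) $ j = real_cond_exp D F (\<lambda>z. snd z $ j) z"
      by (intro AE_finite_allI eta_eq_cond_exp) simp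
    ultimately show ?thesis
      by eventually_elim (simp add: v inner_vec_def)
  qed
  then have "AE z in D. \<forall>h\<in>H. \<eta> (fst z) \<in> h" using H by (intro AE_finite_allI) auto
  then show ?thesis by (simp add: H)
qed

text \<open>A common bound for true and estimated label means, serving integrability only; its value
  never enters the regret bound.\<close>

definition label_bound :: real where
  "label_bound = (SOME B. \<forall>q\<in>convex hull Y. norm q \<le> B)"

lemma label_bound: "q \<in> convex hull Y \<Longrightarrow> norm q \<le> label_bound"
proof -
  have "bounded (convex hull Y)" by (intro bounded_convex_hull finite_imp_bounded finite_Y)
  then have "\<exists>B. \<forall>q\<in>convex hull Y. norm q \<le> B" by (simp add: bounded_iff)
  then show "q \<in> convex hull Y \<Longrightarrow> norm q \<le> label_bound"
    unfolding label_bound_def by (rule someI2_ex) blast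
qed

lemma integrable_eta: "integrable D (\<lambda>z. \<eta> (fst z) $ j)"
proof (rule D.integrable_const_bound)
  show "AE z in D. norm (\<eta> (fst z) $ j) \<le> label_bound"
    using eta_in_convex_hull
    by eventually_elim (metis label_bound component_le_norm_cart real_norm_def order.trans)
qed measurable

text \<open>The characterising property of conditional expectation, tested against functions of the
  input.\<close>

lemma integral_label_mult:
  assumes h: "simple_function X h"
  shows "integrable D (\<lambda>z. snd z $ j * h (fst z))"
    and "integrable D (\<lambda>z. \<eta> (fst z) $ j * h (fst z))"
    and "(\<integral>z. snd z $ j * h (fst z) \<partial>D) = (\<integral>z. \<eta> (fst z) $ j * h (fst z) \<partial>D)"
proof -
  have [measurable]: "h \<in> borel_measurable X" by (rule borel_measurable_simple_function[OF h])
  define B where "B = Max (abs ` h ` space X)"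
  have B: "\<bar>h x\<bar> \<le> B" if "x \<in> space X" for x
    unfolding B_def using h that by (intro Max_ge) (auto simp: simple_function_def)
  have int: "integrable D (\<lambda>z. f z * h (fst z))" if f: "integrable D f" for f
  proof (rule Bochner_Integration.integrable_bound)
    show "integrable D (\<lambda>z. B * f z)" using f by simp
    show "AE z in D. norm (f z * h (fst z)) \<le> norm (B * f z)"
    proof (rule AE_I2)
      fix z assume "z \<in> space D"
      then have "\<bar>h (fst z)\<bar> \<le> \<bar>B\<bar>" using B[of "fst z"] by (auto simp: space_D)
      then show "norm (f z * h (fst z)) \<le> norm (B * f z)"
        by (simp add: abs_mult mult.commute[of "\<bar>f z\<bar>"] mult_right_mono)
    qed
  qed (use f in measurable)
  show 1: "integrable D (\<lambda>z. snd z $ j * h (fst z))"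
    by (rule int) (rule integrable_label)
  show 2: "integrable D (\<lambda>z. \<eta> (fst z) $ j * h (fst z))"
    by (rule int) (rule integrable_eta)
  have "(\<integral>z. h (fst z) * snd z $ j \<partial>D) =
      (\<integral>z. h (fst z) * real_cond_exp D F (\<lambda>z. snd z $ j) z \<partial>D)"
    using 1 integrable_label[of j]
    by (intro cond.real_cond_exp_intg(2)[symmetric] measurable_F) (auto simp: mult.commute)
  also have "\<dots> = (\<integral>z. h (fst z) * \<eta> (fst z) $ j \<partial>D)"
    using eta_eq_cond_exp[of j] by (intro integral_cong_AE) (auto intro: borel_measurable_times)
  finally show "(\<integral>z. snd z $ j * h (fst z) \<partial>D) = (\<integral>z. \<eta> (fst z) $ j * h (fst z) \<partial>D)"
    by (simp add: mult.commute)
qed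


text \<open>Given the input, the prediction is fixed and \<open>K\<close> is affine in the label, so
  the label may be replaced by its conditional mean. \<open>K_expand\<close> reduces this to one
  label coordinate at a time.\<close>

lemma integral_inner_conf:
  assumes p: "p \<in> X \<rightarrow>\<^sub>M count_space P"
  shows "integrable D (\<lambda>z. g \<bullet> conf (snd z) (p (fst z)))"
    and "integrable D (\<lambda>z. g \<bullet> K (\<eta> (fst z)) (p (fst z)))"
    and "(\<integral>z. g \<bullet> conf (snd z) (p (fst z)) \<partial>D) = (\<integral>z. g \<bullet> K (\<eta> (fst z)) (p (fst z)) \<partial>D)"
proof -
  define c where "c x = g \<bullet> K 0 (p x)" for x
  define d where "d j x = g \<bullet> (K (axis j 1) (p x) - K 0 (p x))" for j x
  have expand: "g \<bullet> K q (p x) = c x + (\<Sum>j\<in>UNIV. q $ j * d j x)" for q x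
    unfolding c_def d_def by (subst K_expand) (simp add: inner_add_right inner_sum_right)
  note p_simple = simple_function_count_space[OF p finite_P]
  have d: "simple_function X (d j)" for j
    unfolding d_def by (rule simple_function_compose1[OF p_simple])
  have c: "integrable D (\<lambda>z. c (fst z))"
    unfolding c_def
    by (intro D.integrable_simple_function
        simple_function_compose1[OF simple_function_count_space[OF _ finite_P]]
        measurable_compose[OF measurable_fst_D p])
  have "g \<bullet> conf (snd z) (p (fst z)) = c (fst z) + (\<Sum>j\<in>UNIV. snd z $ j * d j (fst z))"
    if "z \<in> space D" for z
  proof -
    have "snd z \<in> Y" "p (fst z) \<in> P" using that measurable_space[OF p] by (auto simp: space_D)
    then show ?thesis by (simp flip: K_eq_conf expand)
  qed
  note eq = this
  have int1: "integrable D (\<lambda>z. c (fst z) + (\<Sum>j\<in>UNIV. snd z $ j * d j (fst z)))"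
    by (intro Bochner_Integration.integrable_add c Bochner_Integration.integrable_sum
        integral_label_mult(1) d)
  show "integrable D (\<lambda>z. g \<bullet> conf (snd z) (p (fst z)))"
    using int1 by (subst Bochner_Integration.integrable_cong[OF refl eq])
  have int2: "integrable D (\<lambda>z. c (fst z) + (\<Sum>j\<in>UNIV. \<eta> (fst z) $ j * d j (fst z)))"
    by (intro Bochner_Integration.integrable_add c Bochner_Integration.integrable_sum
        integral_label_mult(2) d)
  then show "integrable D (\<lambda>z. g \<bullet> K (\<eta> (fst z)) (p (fst z)))" by (simp add: expand)
  have "(\<integral>z. g \<bullet> conf (snd z) (p (fst z)) \<partial>D) =
      (\<integral>z. c (fst z) + (\<Sum>j\<in>UNIV. snd z $ j * d j (fst z)) \<partial>D)"
    by (rule Bochner_Integration.integral_cong[OF refl eq])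
  also have "\<dots> = (\<integral>z. c (fst z) + (\<Sum>j\<in>UNIV. \<eta> (fst z) $ j * d j (fst z)) \<partial>D)"
    using c integral_label_mult[OF d] by (simp add: Bochner_Integration.integral_sum)
  also have "\<dots> = (\<integral>z. g \<bullet> K (\<eta> (fst z)) (p (fst z)) \<partial>D)" by (simp add: expand)
  finally show "(\<integral>z. g \<bullet> conf (snd z) (p (fst z)) \<partial>D) =
      (\<integral>z. g \<bullet> K (\<eta> (fst z)) (p (fst z)) \<partial>D)" .
qed

lemma integrable_estimation_error:
  assumes [measurable]: "q \<in> borel_measurable X" and q: "\<And>x. x \<in> space X \<Longrightarrow> q x \<in> convex hull Y"
  shows "integrable D (\<lambda>z. norm (\<eta> (fst z) - q (fst z)))"
proof (rule D.integrable_const_bound)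
  show "AE z in D. norm (norm (\<eta> (fst z) - q (fst z))) \<le> label_bound + label_bound"
    using eta_in_convex_hull AE_space
  proof eventually_elim
    case (elim z)
    then have "q (fst z) \<in> convex hull Y" by (intro q) (auto simp: space_D)
    then show ?case
      using elim norm_triangle_ineq4[of "\<eta> (fst z)" "q (fst z)"]
        label_bound[of "\<eta> (fst z)"] label_bound[of "q (fst z)"] by simp
  qed
qed measurable

text \<open>One OMMA decision \<open>p\<close> based on the estimate \<open>q\<close>, against the classifier \<open>h\<close>: replacing
  \<open>q\<close> by \<open>\<eta>\<close> costs \<open>b L\<close> times the estimation error once for \<open>p\<close> and once for \<open>h\<close>.\<close>

lemma plug_in_decision_bound:
  assumes \<psi>: "concave_smooth_utility S \<psi> grad L M" and C: "C \<in> S"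
    and q_meas: "q \<in> borel_measurable X" and q: "\<And>x. x \<in> space X \<Longrightarrow> q x \<in> convex hull Y"
    and p: "p \<in> X \<rightarrow>\<^sub>M count_space P" and h: "h \<in> X \<rightarrow>\<^sub>M count_space P"
    and opt: "\<And>x. x \<in> space X \<Longrightarrow>
      is_arg_max (\<lambda>yh. grad C \<bullet> expected_confusion conf Y (q x) yh) (\<lambda>yh. yh \<in> P) (p x)"
  shows "(\<integral>z. grad C \<bullet> conf (snd z) (h (fst z)) \<partial>D)
    \<le> (\<integral>z. grad C \<bullet> conf (snd z) (p (fst z)) \<partial>D)
      + 2 * b * L * (\<integral>z. norm (\<eta> (fst z) - q (fst z)) \<partial>D)"
proof -
  let ?g = "grad C"
  have L: "0 \<le> L" using \<psi> lipschitz_on_nonneg by (auto simp: concave_smooth_utility_def)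
  \<comment> \<open>Changing the label mean moves \<open>K\<close> by at most \<open>b\<close> times
    the change. Both matrices lie in the closure of \<open>S\<close>, so the gradient turns this
    into a factor \<open>L\<close>.\<close>
  have shift: "?g \<bullet> K r yh \<le> ?g \<bullet> K r' yh + b * L * norm (r - r')"
    if "r \<in> convex hull Y" "r' \<in> convex hull Y" "yh \<in> P" for r r' yh
  proof -
    have "?g \<bullet> (K r yh - K r' yh) \<le> L * norm (K r yh - K r' yh)"
      using that by (intro concave_smooth_utility_gradient_bound[OF
            rationally_convex_achievable_confusions \<psi> C] K_in_closure)
    also have "\<dots> \<le> L * (b * norm (r - r'))"
      using that L by (intro mult_left_mono norm_K_diff)
    finally show ?thesis by (simp add: inner_diff_right mult_ac)
  qed
  have "AE z in D. ?g \<bullet> K (\<eta> (fst z)) (h (fst z)) \<le>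
      ?g \<bullet> K (\<eta> (fst z)) (p (fst z)) + 2 * b * L * norm (\<eta> (fst z) - q (fst z))"
    using eta_in_convex_hull AE_space
  proof eventually_elim
    case (elim z)
    let ?x = "fst z"
    have x: "?x \<in> space X" using elim by (auto simp: space_D)
    have P: "p ?x \<in> P" "h ?x \<in> P"
      using x measurable_space[OF p] measurable_space[OF h] by auto
    have "?g \<bullet> expected_confusion conf Y (q ?x) (h ?x) \<le>
        ?g \<bullet> expected_confusion conf Y (q ?x) (p ?x)"
      using opt[OF x] P by (auto simp: is_arg_max_linorder)
    then have "?g \<bullet> K (q ?x) (h ?x) \<le> ?g \<bullet> K (q ?x) (p ?x)"
      using P q[OF x] by (simp add: expected_confusion_eq)
    moreover have "?g \<bullet> K (\<eta> ?x) (h ?x) \<le> ?g \<bullet> K (q ?x) (h ?x) + b * L * norm (\<eta> ?x - q ?x)"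
      using elim q[OF x] P by (intro shift)
    moreover have "?g \<bullet> K (q ?x) (p ?x) \<le> ?g \<bullet> K (\<eta> ?x) (p ?x) + b * L * norm (q ?x - \<eta> ?x)"
      using elim q[OF x] P by (intro shift)
    ultimately show ?case by (simp add: norm_minus_commute)
  qed
  then have "(\<integral>z. ?g \<bullet> K (\<eta> (fst z)) (h (fst z)) \<partial>D) \<le>
      (\<integral>z. ?g \<bullet> K (\<eta> (fst z)) (p (fst z)) + 2 * b * L * norm (\<eta> (fst z) - q (fst z)) \<partial>D)"
    by (intro integral_mono_AE integral_inner_conf(2)[OF h] integral_inner_conf(2)[OF p]
        Bochner_Integration.integrable_add integrable_mult_right
        integrable_estimation_error[OF q_meas q])
  also have "\<dots> = (\<integral>z. ?g \<bullet> K (\<eta> (fst z)) (p (fst z)) \<partial>D)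
      + 2 * b * L * (\<integral>z. norm (\<eta> (fst z) - q (fst z)) \<partial>D)"
    using integral_inner_conf(2)[OF p, of ?g] integrable_estimation_error[OF q_meas q] by simp
  finally show ?thesis by (simp add: integral_inner_conf(3)[OF h] integral_inner_conf(3)[OF p])
qed

end

section \<open>The regret recursion\<close>

lemma at_trial_cong:
  assumes "\<And>s. s \<in> {1..t} \<Longrightarrow> z s = z' s" "t \<ge> 1"
  shows "at_trial g t z = at_trial g t z'"
proof -
  have "restrict z {1..<t} = restrict z' {1..<t}" using assms by (intro restrict_ext) auto
  then show ?thesis using assms by (simp add: at_trial_def)
qed

lemma omma_confusion_cong:
  assumes "\<And>s. s \<in> {1..t} \<Longrightarrow> z s = z' s"
  shows "omma_confusion conf C0 pred z t = omma_confusion conf C0 pred z' t"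
  using assms
proof (induction t)
  case (Suc t)
  have "at_trial pred (Suc t) z = at_trial pred (Suc t) z'" using Suc.prems by (intro at_trial_cong) auto
  then show ?case using Suc by simp
qed simp

text \<open>In the first update the weight of \<open>C0\<close> is \<open>0 / 1\<close>, so the
  initial matrix leaves no trace; every later update only changes the normalisation and adds a
  term.\<close>

lemma omma_confusion_eq_empirical:
  assumes "t \<ge> 1"
  shows "omma_confusion conf C0 pred z t =
    empirical_confusion conf t (\<lambda>s. snd (z s)) (\<lambda>s. at_trial pred s z)"
  using assms
proof (induction t rule: nat_induct_at_least)
  case (Suc t)
  have "(real t / real (Suc t)) *\<^sub>R ((1 / real t) *\<^sub>R A) = (1 / real (Suc t)) *\<^sub>R A" for A :: 'a
    using Suc.hyps by simp
  then show ?case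
    by (simp add: Suc.IH empirical_confusion_def scaleR_add_right del: of_nat_Suc)
qed (simp add: empirical_confusion_def)

text \<open>The index set \<open>I\<close> stays free because the rule is read both on the full
  sample and on its first \<open>t\<close> trials.\<close>

lemma measurable_at_trial:
  assumes g: "(\<lambda>(past, x). g t past x) \<in> past_law t D \<Otimes>\<^sub>M X \<rightarrow>\<^sub>M N"
    and D: "fst \<in> D \<rightarrow>\<^sub>M X" and I: "{1..t} \<subseteq> I" and t: "t \<ge> 1"
  shows "at_trial g t \<in> PiM I (\<lambda>_. D) \<rightarrow>\<^sub>M N"
proof -
  have "(\<lambda>z. (restrict z {1..<t}, fst (z t))) \<in> PiM I (\<lambda>_. D) \<rightarrow>\<^sub>M past_law t D \<Otimes>\<^sub>M X"
  proof (rule measurable_Pair)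
    show "(\<lambda>z. restrict z {1..<t}) \<in> PiM I (\<lambda>_. D) \<rightarrow>\<^sub>M past_law t D"
      using I by (intro measurable_restrict_subset) auto
    show "(\<lambda>z. fst (z t)) \<in> PiM I (\<lambda>_. D) \<rightarrow>\<^sub>M X"
      using I t by (intro measurable_compose[OF _ D] measurable_component_singleton) auto
  qed
  from measurable_compose[OF this g] show ?thesis by (simp add: at_trial_def[abs_def])
qed

locale omma_run = label_model conf K Y P a b X D \<eta>
  for conf K :: "real ^ 'm \<Rightarrow> real ^ 'm \<Rightarrow> 'c::euclidean_space" and Y P a b
    and X :: "'x measure" and D \<eta> +
  fixes n :: nat and \<psi> :: "'c \<Rightarrow> real" and grad :: "'c \<Rightarrow> 'c" and L M :: real and C0 :: 'c
    and \<eta>h pred :: "nat \<Rightarrow> (nat \<Rightarrow> 'x \<times> (real ^ 'm)) \<Rightarrow> 'x \<Rightarrow> real ^ 'm" and h :: "'x \<Rightarrow> real ^ 'm"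
  assumes n: "n \<ge> 1"
    and estimator: "online_estimator X Y D n \<eta>h"
    and utility: "concave_smooth_utility S \<psi> grad L M"
    and C0: "C0 \<in> S"
    and omma: "omma conf X Y P D n grad C0 \<eta>h pred"
    and h: "h \<in> X \<rightarrow>\<^sub>M count_space P"
begin

abbreviation "C t z \<equiv> omma_confusion conf C0 pred z t"
abbreviation "c t z \<equiv> conf (snd (z t)) (at_trial pred t z)"

section \<open>Measurability, range and integrability along a run\<close>

lemma prob_space_PiM_D: "prob_space (PiM I (\<lambda>_. D))"
  by (intro prob_space_PiM D.prob_space_axioms)

lemma pred_measurable:
  "t \<in> {1..n} \<Longrightarrow> (\<lambda>(past, x). pred t past x) \<in> past_law t D \<Otimes>\<^sub>M X \<rightarrow>\<^sub>M count_space P"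
  using omma by (simp add: omma_def)

lemma at_trial_pred_measurable:
  assumes "{1..t} \<subseteq> I" "t \<in> {1..n}"
  shows "at_trial pred t \<in> PiM I (\<lambda>_. D) \<rightarrow>\<^sub>M count_space P"
  using assms by (intro measurable_at_trial[OF pred_measurable measurable_fst_D]) auto

lemma snd_measurable:
  assumes "t \<in> I"
  shows "(\<lambda>z. snd (z t)) \<in> PiM I (\<lambda>_. D) \<rightarrow>\<^sub>M count_space Y"
  by (rule measurable_compose[OF measurable_component_singleton[OF assms] measurable_snd_D])

lemma simple_function_c:
  assumes "{1..t} \<subseteq> I" "t \<in> {1..n}"
  shows "simple_function (PiM I (\<lambda>_. D)) (c t)"
  using assms
  by (intro simple_function_compose2[where h = conf]
      simple_function_count_space[OF snd_measurable finite_Y]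
      simple_function_count_space[OF at_trial_pred_measurable finite_P]) auto

lemma simple_function_C:
  assumes "{1..t} \<subseteq> I" "t \<le> n"
  shows "simple_function (PiM I (\<lambda>_. D)) (C t)"
  using assms
proof (induction t)
  case (Suc t)
  have "{1..t} \<subseteq> I" using Suc.prems by (auto simp: subset_iff)
  then have "simple_function (PiM I (\<lambda>_. D)) (C t)" using Suc by simp
  moreover have "simple_function (PiM I (\<lambda>_. D)) (c (Suc t))"
    using Suc by (intro simple_function_c) auto
  ultimately show ?case
    using simple_function_compose2[of "PiM I (\<lambda>_. D)" "C t" "c (Suc t)"
        "\<lambda>A B. (real t / real (Suc t)) *\<^sub>R A + (1 / real (Suc t)) *\<^sub>R B"] by simp
qed simp

lemma in_label_sets:
  assumes z: "z \<in> space (PiM I (\<lambda>_. D))" and "{1..t} \<subseteq> I" "t \<in> {1..n}"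
  shows "snd (z t) \<in> Y" "at_trial pred t z \<in> P"
  using measurable_space[OF snd_measurable z, of t]
    measurable_space[OF at_trial_pred_measurable z, of t] assms by auto

lemma C_achievable:
  assumes z: "z \<in> space (PiM I (\<lambda>_. D))" and I: "{1..t} \<subseteq> I" and t: "t \<le> n"
  shows "C t z \<in> S"
proof (cases "t = 0")
  \<comment> \<open>Before trial 1 the run sits at \<open>C0\<close>, which lies in \<open>S\<close>
    by assumption, so the estimates at trial 1 are the same as later.\<close>
  case True then show ?thesis using C0 by simp
next
  case False
  have "snd (z s) \<in> Y \<and> at_trial pred s z \<in> P" if "s \<in> {1..t}" for s
  proof -
    have "{1..s} \<subseteq> I" "s \<in> {1..n}" using that I t by (auto simp: subset_iff)
    then show ?thesis using in_label_sets[OF z] by blast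
  qed
  moreover have "C t z = empirical_confusion conf t (\<lambda>s. snd (z s)) (\<lambda>s. at_trial pred s z)"
    using False by (intro omma_confusion_eq_empirical) simp
  moreover have "t \<ge> 1" using False by simp
  ultimately show ?thesis unfolding achievable_confusions_def by blast
qed

text \<open>Marginalising to the first \<open>t\<close> trials and then splitting off trial
  \<open>t\<close> by Fubini expresses conditioning on the past.\<close>

lemma integral_sample_law:
  fixes f :: "_ \<Rightarrow> real"
  assumes t: "t \<in> {1..n}" and f: "integrable (PiM {1..t} (\<lambda>_. D)) f"
  shows "(\<integral>z. f (restrict z {1..t}) \<partial>sample_law n D) =
    (\<integral>past. (\<integral>w. f (past(t := w)) \<partial>D) \<partial>past_law t D)"
proof -
  interpret S: product_prob_space "\<lambda>_. D" "{1..n}" by unfold_locales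
  have I: "{1..t} \<subseteq> {1..n}" "{1..t} = insert t {1..<t}" using t by auto
  have "(\<integral>z. f (restrict z {1..t}) \<partial>sample_law n D) =
      (\<integral>z. f z \<partial>distr (sample_law n D) (PiM {1..t} (\<lambda>_. D)) (\<lambda>z. restrict z {1..t}))"
    using I(1) f by (intro integral_distr[symmetric] measurable_restrict_subset) auto
  also have "\<dots> = (\<integral>z. f z \<partial>PiM {1..t} (\<lambda>_. D))"
    by (subst S.distr_restrict[OF I(1), symmetric]) auto
  also have "\<dots> = (\<integral>past. (\<integral>w. f (past(t := w)) \<partial>D) \<partial>past_law t D)"
    using f unfolding I(2) by (intro S.product_integral_insert) auto
  finally show ?thesis .
qed

definition Cstar :: 'c where
  "Cstar = (\<integral>w. conf (snd w) (h (fst w)) \<partial>D)"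

lemma integrable_conf_h: "integrable D (\<lambda>w. conf (snd w) (h (fst w)))"
  by (intro D.integrable_simple_function simple_function_compose2[where h = conf]
      simple_function_count_space[OF measurable_snd_D finite_Y]
      simple_function_count_space[OF measurable_compose[OF measurable_fst_D h] finite_P])

lemma inner_Cstar: "g \<bullet> Cstar = (\<integral>w. g \<bullet> conf (snd w) (h (fst w)) \<partial>D)"
  unfolding Cstar_def using integrable_conf_h by simp

lemma eta_h_in_hull:
  assumes z: "z \<in> space (PiM I (\<lambda>_. D))" and I: "{1..t} \<subseteq> I" and t: "t \<in> {1..n}"
  shows "at_trial \<eta>h t z \<in> convex hull Y"
proof -
  have "restrict z {1..<t} \<in> space (past_law t D)"
    using z I by (auto simp: space_PiM PiE_iff subset_iff)
  moreover have "z t \<in> space D" using z I t by (auto simp: space_PiM PiE_iff)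
  then have "fst (z t) \<in> space X" by (auto simp: space_D)
  ultimately show ?thesis
    using estimator t by (auto simp: online_estimator_def at_trial_def)
qed

lemma integrable_error:
  assumes I: "{1..t} \<subseteq> I" and t: "t \<in> {1..n}"
  shows "integrable (PiM I (\<lambda>_. D)) (\<lambda>z. norm (\<eta> (fst (z t)) - at_trial \<eta>h t z))"
proof -
  interpret S: prob_space "PiM I (\<lambda>_. D)" by (rule prob_space_PiM_D)
  have "t \<in> I" using I t by auto
  have [measurable]: "at_trial \<eta>h t \<in> borel_measurable (PiM I (\<lambda>_. D))"
    using estimator I t by (intro measurable_at_trial[where X = X]) (auto simp: online_estimator_def)
  have [measurable]: "(\<lambda>z. \<eta> (fst (z t))) \<in> borel_measurable (PiM I (\<lambda>_. D))"
    using \<open>t \<in> I\<close> by measurable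
  have "AE z in PiM I (\<lambda>_. D). \<eta> (fst (z t)) \<in> convex hull Y"
    using \<open>t \<in> I\<close> D.prob_space_axioms eta_in_convex_hull by (intro AE_PiM_component) auto
  then have "AE z in PiM I (\<lambda>_. D).
      norm (norm (\<eta> (fst (z t)) - at_trial \<eta>h t z)) \<le> label_bound + label_bound"
    using AE_space
  proof eventually_elim
    case (elim z)
    then have "at_trial \<eta>h t z \<in> convex hull Y" using eta_h_in_hull I t by blast
    then show ?case
      using elim norm_triangle_ineq4[of "\<eta> (fst (z t))" "at_trial \<eta>h t z"]
        label_bound[of "\<eta> (fst (z t))"] label_bound[of "at_trial \<eta>h t z"] by simp
  qed
  then show ?thesis by (intro S.integrable_const_bound) measurable
qed

lemma integrable_simple_PiM:
  fixes f :: "_ \<Rightarrow> real"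
  shows "simple_function (PiM I (\<lambda>_. D)) f \<Longrightarrow> integrable (PiM I (\<lambda>_. D)) f"
  by (rule finite_measure.integrable_simple_function[OF
        prob_space.finite_measure[OF prob_space_PiM_D]])

lemma integrable_grad:
  assumes "{1..t} \<subseteq> I" "t \<in> {1..n}"
  shows "integrable (PiM I (\<lambda>_. D)) (\<lambda>z. grad (C (t - 1) z) \<bullet> (Cstar - c t z))"
  using assms
  by (intro integrable_simple_PiM simple_function_compose2[where h = "\<lambda>A B. grad A \<bullet> (Cstar - B)"]
      simple_function_C simple_function_c) (auto simp: subset_iff)

text \<open>With the past frozen, the matrix \<open>C (t - 1)\<close>, the estimate and the decision
  rule are deterministic functions, and trial \<open>t\<close> is a fresh draw from
  \<open>D\<close>; \<open>plug_in_decision_bound\<close> applies to it and is then averaged over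
  the past.\<close>

lemma expected_linear_regret:
  assumes t: "t \<in> {1..n}"
  shows "(\<integral>z. grad (C (t - 1) z) \<bullet> (Cstar - c t z) \<partial>sample_law n D)
    \<le> 2 * b * L * estimation_error D n \<eta> \<eta>h t"
proof -
  \<comment> \<open>\<open>H\<close> is the slack of the claim at one sample; its integral over
    trial \<open>t\<close> is nonnegative for every past.\<close>
  define H where "H z = 2 * b * L * norm (\<eta> (fst (z t)) - at_trial \<eta>h t z)
    - grad (C (t - 1) z) \<bullet> (Cstar - c t z)" for z
  have H_int: "integrable (PiM I (\<lambda>_. D)) H" if "{1..t} \<subseteq> I" for I
    unfolding H_def using that t
    by (intro Bochner_Integration.integrable_diff integrable_mult_right integrable_error integrable_grad)
  have H_restrict: "H (restrict z {1..t}) = H z" for z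
  proof -
    have "at_trial g t (restrict z {1..t}) = at_trial g t z" for g :: "_ \<Rightarrow> _ \<Rightarrow> _ \<Rightarrow> real ^ 'm"
      using t by (intro at_trial_cong) auto
    moreover have "C (t - 1) (restrict z {1..t}) = C (t - 1) z"
      by (intro omma_confusion_cong) auto
    ultimately show ?thesis using t by (simp add: H_def)
  qed
  have inner: "0 \<le> (\<integral>w. H (past(t := w)) \<partial>D)" if past: "past \<in> space (past_law t D)" for past
  proof -
    \<comment> \<open>Points of \<open>past_law t D\<close> are \<open>undefined\<close> outside
      \<open>{1..<t}\<close>, so restricting after the update at \<open>t\<close> recovers
      \<open>past\<close> exactly.\<close>
    have restr: "restrict (past(t := w)) {1..<t} = past" for w
      using past by (auto simp: space_PiM PiE_iff extensional_def restrict_def fun_eq_iff)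
    have Ceq: "C (t - 1) (past(t := w)) = C (t - 1) past" for w
      using t by (intro omma_confusion_cong) auto
    let ?p = "pred t past" and ?q = "\<eta>h t past" and ?g = "grad (C (t - 1) past)"
    have H_eq: "H (past(t := w)) = 2 * b * L * norm (\<eta> (fst w) - ?q (fst w))
        - (?g \<bullet> Cstar - ?g \<bullet> conf (snd w) (?p (fst w)))" for w
      unfolding H_def Ceq at_trial_def restr by (simp add: inner_diff_right)
    have C: "C (t - 1) past \<in> S" using past t by (intro C_achievable) auto
    have p: "?p \<in> X \<rightarrow>\<^sub>M count_space P"
      using measurable_Pair2[OF pred_measurable[OF t] past] by simp
    have "(\<lambda>(past, x). \<eta>h t past x) \<in> borel_measurable (past_law t D \<Otimes>\<^sub>M X)"
      using estimator t by (simp add: online_estimator_def)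
    from measurable_Pair2[OF this past] have q: "?q \<in> borel_measurable X" by simp
    have q_hull: "?q x \<in> convex hull Y" if "x \<in> space X" for x
      using estimator t past that by (simp add: online_estimator_def)
    have opt: "is_arg_max (\<lambda>yh. ?g \<bullet> expected_confusion conf Y (?q x) yh) (\<lambda>yh. yh \<in> P) (?p x)"
      if "x \<in> space X" for x
      using omma t past that by (simp add: omma_def)
    have "(\<integral>w. H (past(t := w)) \<partial>D) = 2 * b * L * (\<integral>w. norm (\<eta> (fst w) - ?q (fst w)) \<partial>D)
        - (?g \<bullet> Cstar - (\<integral>w. ?g \<bullet> conf (snd w) (?p (fst w)) \<partial>D))"
      unfolding H_eq
      using integrable_estimation_error[OF q q_hull] integral_inner_conf(1)[OF p, of ?g]
      by (simp add: D.prob_space)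
    then show ?thesis
      using plug_in_decision_bound[OF utility C q q_hull p h opt] by (simp add: inner_Cstar)
  qed
  have "0 \<le> (\<integral>past. (\<integral>w. H (past(t := w)) \<partial>D) \<partial>past_law t D)"
    by (intro integral_nonneg_AE AE_I2 inner)
  also have "\<dots> = (\<integral>z. H z \<partial>sample_law n D)"
    using integral_sample_law[OF t H_int] H_restrict by simp
  also have "\<dots> = 2 * b * L * estimation_error D n \<eta> \<eta>h t
      - (\<integral>z. grad (C (t - 1) z) \<bullet> (Cstar - c t z) \<partial>sample_law n D)"
    unfolding H_def estimation_error_def using t integrable_error[of t "{1..n}"] integrable_grad[of t "{1..n}"]
    by simp
  finally show ?thesis by simp
qed

section \<open>Expected utilities and the recursion between consecutive trials\<close>

definition V :: "nat \<Rightarrow> real" where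
  "V t = (\<integral>z. \<psi> (C t z) \<partial>sample_law n D)"

definition U :: real where
  "U = classifier_utility conf D n \<psi> h"

lemma integrable_utility: "t \<le> n \<Longrightarrow> integrable (sample_law n D) (\<lambda>z. \<psi> (C t z))"
  by (intro integrable_simple_PiM simple_function_compose1[OF simple_function_C]) auto

lemma V_n: "V n = online_utility conf D n \<psi> pred"
  using n by (simp add: V_def online_utility_def omma_confusion_eq_empirical)

text \<open>The linearisation at the fixed matrix \<open>A\<close> is affine, so its expectation
  depends only on the mean of the comparator's empirical matrix. That mean is \<open>Cstar\<close>,
  since every single trial has law \<open>D\<close>.\<close>

lemma U_le:
  assumes A: "A \<in> S"
  shows "U \<le> \<psi> A + grad A \<bullet> (Cstar - A)"
proof -
  interpret S: prob_space "sample_law n D" by (rule prob_space_PiM_D)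
  let ?E = "\<lambda>z. empirical_confusion conf n (\<lambda>t. snd (z t)) (\<lambda>t. h (fst (z t)))"
  have E_simple: "simple_function (sample_law n D) ?E"
    unfolding empirical_confusion_def
    by (intro simple_function_compose1[where g = "\<lambda>A. (1 / real n) *\<^sub>R A"] simple_function_sum
        simple_function_compose2[where h = conf]
        simple_function_count_space[OF snd_measurable finite_Y]
        simple_function_count_space[OF _ finite_P]
        measurable_compose[OF _ measurable_compose[OF measurable_fst_D h]]
        measurable_component_singleton) auto
  have E_S: "?E z \<in> S" if z: "z \<in> space (sample_law n D)" for z
  proof -
    have "z s \<in> space D" if "s \<in> {1..n}" for s using z that by (auto simp: space_PiM PiE_iff)
    then have "snd (z s) \<in> Y" "h (fst (z s)) \<in> P" if "s \<in> {1..n}" for s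
      using measurable_space[OF h, of "fst (z s)"] that by (fastforce simp: space_D)+
    then show ?thesis unfolding achievable_confusions_def using n by blast
  qed
  have component: "integrable (sample_law n D) (\<lambda>z. conf (snd (z t)) (h (fst (z t))))"
    "(\<integral>z. conf (snd (z t)) (h (fst (z t))) \<partial>sample_law n D) = Cstar" if t: "t \<in> {1..n}" for t
  proof -
    have d: "distr (sample_law n D) D (\<lambda>z. z t) = D"
      using t by (intro distr_PiM_component D.prob_space_axioms)
    have "integrable (distr (sample_law n D) D (\<lambda>z. z t)) (\<lambda>w. conf (snd w) (h (fst w)))"
      unfolding d by (rule integrable_conf_h)
    then show "integrable (sample_law n D) (\<lambda>z. conf (snd (z t)) (h (fst (z t))))"
      using t by (subst (asm) integrable_distr_eq) (auto intro: borel_measurable_integrable[OF integrable_conf_h])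
    have "Cstar = (\<integral>w. conf (snd w) (h (fst w)) \<partial>distr (sample_law n D) D (\<lambda>z. z t))"
      unfolding d Cstar_def ..
    also have "\<dots> = (\<integral>z. conf (snd (z t)) (h (fst (z t))) \<partial>sample_law n D)"
      using t by (intro integral_distr borel_measurable_integrable[OF integrable_conf_h]) auto
    finally show "(\<integral>z. conf (snd (z t)) (h (fst (z t))) \<partial>sample_law n D) = Cstar" ..
  qed
  have E_int: "integrable (sample_law n D) ?E"
    by (rule S.integrable_simple_function[OF E_simple])
  have "(\<integral>z. ?E z \<partial>sample_law n D) = (1 / real n) *\<^sub>R (\<Sum>t = 1..n. Cstar)"
    unfolding empirical_confusion_def using component by (simp add: Bochner_Integration.integral_sum)
  then have E_mean: "(\<integral>z. ?E z \<partial>sample_law n D) = Cstar" using n by (simp add: sum_constant_scaleR)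
  have "U \<le> (\<integral>z. \<psi> A + grad A \<bullet> (?E z - A) \<partial>sample_law n D)"
    unfolding U_def classifier_utility_def
  proof (rule integral_mono)
    show "integrable (sample_law n D) (\<lambda>z. \<psi> (?E z))"
      by (rule integrable_simple_PiM[OF simple_function_compose1[OF E_simple]])
    show "integrable (sample_law n D) (\<lambda>z. \<psi> A + grad A \<bullet> (?E z - A))"
      by (rule integrable_simple_PiM[OF simple_function_compose1[OF E_simple]])
    show "\<psi> (?E z) \<le> \<psi> A + grad A \<bullet> (?E z - A)" if "z \<in> space (sample_law n D)" for z
      using utility A E_S[OF that] by (simp add: concave_smooth_utility_def)
  qed
  also have "\<dots> = \<psi> A + grad A \<bullet> (Cstar - A)"
    using E_int E_mean by (simp add: S.prob_space inner_diff_right del: One_nat_def)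
  finally show ?thesis .
qed

text \<open>One update moves the matrix by \<open>(c t z - C (t - 1) z) / t\<close>. The direction
  is split through \<open>Cstar\<close>: the part towards \<open>Cstar\<close> gains by
  \<open>U_le\<close>, the rest is the linear regret of the trial.\<close>

lemma utility_step:
  assumes z: "z \<in> space (sample_law n D)" and t: "t \<in> {1..n}"
  shows "\<psi> (C (t - 1) z) + (U - \<psi> (C (t - 1) z)) / real t
      - (grad (C (t - 1) z) \<bullet> (Cstar - c t z)) / real t - M * a / (real t)\<^sup>2 \<le> \<psi> (C t z)"
proof -
  let ?C = "C (t - 1) z"
  have t0: "real t > 0" using t by simp
  have C: "?C \<in> S" "C t z \<in> S" using t by (auto intro!: C_achievable[OF z])
  have M: "0 \<le> M" using utility lipschitz_on_nonneg by (auto simp: concave_smooth_utility_def)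
  obtain k where k: "t = Suc k" using t by (cases t) auto
  have "real k / real (Suc k) = 1 - 1 / real (Suc k)" by (simp add: field_simps)
  then have diff: "C t z - ?C = (1 / real t) *\<^sub>R (c t z - ?C)"
    by (simp add: k scaleR_diff_left scaleR_diff_right del: of_nat_Suc)
  have "(norm (c t z - ?C))\<^sup>2 \<le> 2 * a"
    using in_label_sets[OF z _ t] t C by (intro norm_conf_minus_achievable) auto
  then have "M / 2 * (norm (C t z - ?C))\<^sup>2 \<le> M / 2 * (2 * a / (real t)\<^sup>2)"
    unfolding diff using M t0
    by (intro mult_left_mono) (auto simp: power_divide divide_right_mono)
  also have "\<dots> = M * a / (real t)\<^sup>2" by simp
  finally have "M / 2 * (norm (C t z - ?C))\<^sup>2 \<le> M * a / (real t)\<^sup>2" .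
  moreover have "\<psi> ?C + grad ?C \<bullet> (C t z - ?C) - M / 2 * (norm (C t z - ?C))\<^sup>2 \<le> \<psi> (C t z)"
    by (intro concave_smooth_utility_lower_bound[OF rationally_convex_achievable_confusions utility] C)
  moreover have "grad ?C \<bullet> (C t z - ?C) =
      (grad ?C \<bullet> (Cstar - ?C)) / real t - (grad ?C \<bullet> (Cstar - c t z)) / real t"
    unfolding diff by (simp add: inner_diff_right diff_divide_distrib)
  \<comment> \<open>\<open>U_le\<close> holds for every fixed matrix in \<open>S\<close>, so it may
    be used pointwise at the random value \<open>?C\<close>.\<close>
  moreover have "(U - \<psi> ?C) / real t \<le> (grad ?C \<bullet> (Cstar - ?C)) / real t"
    using U_le[OF C(1)] t0 by (intro divide_right_mono) auto
  ultimately show ?thesis by linarith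
qed

text \<open>Integrating \<open>utility_step\<close> and multiplying by \<open>t\<close> leaves
  \<open>t - 1\<close> copies of the previous gap, because the gain already contributes
  \<open>U - V (t - 1)\<close> once.\<close>

lemma regret_step:
  assumes t: "t \<in> {1..n}"
  shows "real t * (U - V t) \<le> real (t - 1) * (U - V (t - 1))
    + 2 * b * L * estimation_error D n \<eta> \<eta>h t + M * a / real t"
proof -
  interpret S: prob_space "sample_law n D" by (rule prob_space_PiM_D)
  let ?G = "\<lambda>z. grad (C (t - 1) z) \<bullet> (Cstar - c t z)"
  have t0: "real t > 0" using t by simp
  have scale: "r * (v + (u - v) / r - g / r - m / r\<^sup>2) = r * v + (u - v) - g - m / r"
    if "r > 0" for r u v g m :: real
    using that by (simp add: field_simps power2_eq_square)
  have int1: "integrable (sample_law n D) ?G" by (rule integrable_grad) (use t in auto)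
  have int2: "integrable (sample_law n D) (\<lambda>z. \<psi> (C (t - 1) z))"
    by (rule integrable_utility) (use t in auto)
  have int3: "integrable (sample_law n D) (\<lambda>z. \<psi> (C t z))"
    by (rule integrable_utility) (use t in auto)
  note int = int1 int2 int3
  have "(\<integral>z. \<psi> (C (t - 1) z) + (U - \<psi> (C (t - 1) z)) / real t - ?G z / real t
      - M * a / (real t)\<^sup>2 \<partial>sample_law n D) \<le> V t"
    unfolding V_def using int t
    by (intro integral_mono utility_step) (auto simp del: One_nat_def)
  also have "(\<integral>z. \<psi> (C (t - 1) z) + (U - \<psi> (C (t - 1) z)) / real t - ?G z / real t
      - M * a / (real t)\<^sup>2 \<partial>sample_law n D) =
      V (t - 1) + (U - V (t - 1)) / real t - (\<integral>z. ?G z \<partial>sample_law n D) / real t - M * a / (real t)\<^sup>2"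
    unfolding V_def using int by (simp add: S.prob_space del: One_nat_def)
  finally have "real t * (V (t - 1) + (U - V (t - 1)) / real t
      - (\<integral>z. ?G z \<partial>sample_law n D) / real t - M * a / (real t)\<^sup>2) \<le> real t * V t"
    using t0 by (intro mult_left_mono) auto
  then have "real t * V (t - 1) + (U - V (t - 1)) - (\<integral>z. ?G z \<partial>sample_law n D) - M * a / real t
      \<le> real t * V t"
    unfolding scale[OF t0] .
  then show ?thesis
    using expected_linear_regret[OF t] t by (simp add: of_nat_diff algebra_simps)
qed

lemma regret_bound:
  "regret conf D n \<psi> h pred \<le> M * a * (1 + ln (real n)) / real n
    + 2 * b * L / real n * (\<Sum>t = 1..n. estimation_error D n \<eta> \<eta>h t)"
proof -
  \<comment> \<open>The induction can start at \<open>t = 0\<close>: the factor \<open>0\<close>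
    removes the gap at \<open>C0\<close>.\<close>
  have sum: "real t * (U - V t) \<le>
      2 * b * L * (\<Sum>s = 1..t. estimation_error D n \<eta> \<eta>h s) + M * a * harm t" if "t \<le> n" for t
    using that
  proof (induction t)
    case (Suc t)
    then show ?case
      using regret_step[of "Suc t"] by (simp add: harm_Suc algebra_simps inverse_eq_divide)
  qed (simp add: harm_def)
  \<comment> \<open>The sign permits replacing \<open>harm n\<close> by its logarithmic bound.
    Nonnegativity of \<open>a\<close> is read off from the norm bound at some sample point, which
    exists in a probability space.\<close>
  have "0 \<le> M * a"
  proof -
    have "0 \<le> M" using utility lipschitz_on_nonneg by (auto simp: concave_smooth_utility_def)
    moreover have "0 \<le> a"
    proof -
      obtain z where z: "z \<in> space (sample_law n D)"
        using prob_space.not_empty[OF prob_space_PiM_D] by blast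
      have "(norm (conf (snd (z 1)) (at_trial pred 1 z) - C0))\<^sup>2 \<le> 2 * a"
        using in_label_sets[OF z, of 1] n C0 by (intro norm_conf_minus_achievable) auto
      then show ?thesis
        using zero_le_power2[of "norm (conf (snd (z 1)) (at_trial pred 1 z) - C0)"] by linarith
    qed
    ultimately show ?thesis by simp
  qed
  then have "M * a * harm n \<le> M * a * (1 + ln (real n))"
    using harm_le_one_plus_ln[OF n] by (intro mult_left_mono)
  with sum[of n] have "real n * (U - V n) \<le>
      M * a * (1 + ln (real n)) + 2 * b * L * (\<Sum>s = 1..n. estimation_error D n \<eta> \<eta>h s)"
    by simp
  then have "U - V n \<le>
      (M * a * (1 + ln (real n)) + 2 * b * L * (\<Sum>s = 1..n. estimation_error D n \<eta> \<eta>h s)) / real n"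
    using n by (simp add: pos_le_divide_eq mult.commute)
  then show ?thesis by (simp add: regret_def U_def V_n add_divide_distrib)
qed

end

section \<open>Multi-class and multi-label confusion\<close>

lemma sum_power2_binary:
  assumes "y \<in> binary_vectors"
  shows "(norm y)\<^sup>2 = (\<Sum>j\<in>UNIV. y $ j)"
proof -
  have "y $ j * y $ j = y $ j" for j using assms by (auto simp: binary_vectors_def)
  then show ?thesis unfolding power2_norm_eq_inner inner_vec_def inner_real_def by (rule sum.cong[OF refl])
qed

lemma norm_one_hot: "y \<in> one_hot_vectors \<Longrightarrow> norm y = 1"
  using sum_power2_binary[of y] real_sqrt_abs[of "norm y"] by (simp add: one_hot_vectors_def)

lemma inner_binary_nonneg:
  assumes "y \<in> binary_vectors" "y' \<in> binary_vectors"
  shows "0 \<le> y \<bullet> y'"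
  unfolding inner_vec_def
proof (rule sum_nonneg)
  fix j
  have "y $ j \<in> {0, 1}" "y' $ j \<in> {0, 1}" using assms by (simp_all add: binary_vectors_def)
  then show "0 \<le> y $ j \<bullet> y' $ j" by auto
qed

lemma norm_diff_power2_le:
  assumes "0 \<le> A \<bullet> B"
  shows "(norm (A - B))\<^sup>2 \<le> (norm A)\<^sup>2 + (norm B)\<^sup>2"
  using assms by (simp add: power2_norm_eq_inner inner_diff_left inner_diff_right inner_commute)

text \<open>The matrix is the outer product of label and prediction, and the Frobenius inner product
  of outer products factorises.\<close>

lemma inner_multiclass_confusion:
  "multiclass_confusion u p \<bullet> multiclass_confusion v s = (u \<bullet> v) * (p \<bullet> s)"
  by (simp add: multiclass_confusion_def inner_vec_def sum_product) (simp add: mult_ac)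

lemma norm_multiclass_confusion: "norm (multiclass_confusion u p) = norm u * norm p"
  by (simp add: norm_eq_sqrt_inner inner_multiclass_confusion real_sqrt_mult)

lemma finite_one_hot_vectors: "finite (one_hot_vectors :: (real ^ 'm) set)"
  using finite_binary_vectors by (rule rev_finite_subset) (auto simp: one_hot_vectors_def)

text \<open>The outer product is already linear in the label, so it serves as its own extension.
  One-hot vectors have norm 1, whence both constants.\<close>

lemma affine_confusion_multiclass:
  "affine_confusion (multiclass_confusion :: real ^ 'm \<Rightarrow> _) multiclass_confusion
     one_hot_vectors one_hot_vectors 1 1"
proof (rule affine_confusion.intro)
  fix p :: "real ^ 'm"
  show "linear (\<lambda>q. multiclass_confusion q p - multiclass_confusion 0 p)"
    by (rule linearI) (simp_all add: multiclass_confusion_def vec_eq_iff algebra_simps)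
next
  fix q p :: "real ^ 'm"
  assume "q \<in> convex hull one_hot_vectors" "p \<in> one_hot_vectors"
  then show "expected_confusion multiclass_confusion one_hot_vectors q p = multiclass_confusion q p"
    by (simp add: expected_multiclass_confusion multiclass_confusion_def)
next
  fix p q r :: "real ^ 'm"
  assume "p \<in> one_hot_vectors"
  moreover have "multiclass_confusion q p - multiclass_confusion r p = multiclass_confusion (q - r) p"
    by (simp add: multiclass_confusion_def vec_eq_iff left_diff_distrib)
  ultimately show "norm (multiclass_confusion q p - multiclass_confusion r p) \<le> 1 * norm (q - r)"
    by (simp add: norm_multiclass_confusion norm_one_hot)
next
  fix y y' p p' :: "real ^ 'm"
  assume *: "y \<in> one_hot_vectors" "y' \<in> one_hot_vectors" "p \<in> one_hot_vectors" "p' \<in> one_hot_vectors"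
  then have "0 \<le> multiclass_confusion y p \<bullet> multiclass_confusion y' p'"
    unfolding inner_multiclass_confusion
    by (intro mult_nonneg_nonneg inner_binary_nonneg) (auto simp: one_hot_vectors_def)
  from norm_diff_power2_le[OF this] *
  show "(norm (multiclass_confusion y p - multiclass_confusion y' p'))\<^sup>2 \<le> 2 * 1"
    by (simp add: norm_multiclass_confusion norm_one_hot)
qed (auto simp: finite_one_hot_vectors)

text \<open>The indicators of \<open>y $ j = 1\<close> and \<open>y $ j = 0\<close> agree with
  \<open>y $ j\<close> and \<open>1 - y $ j\<close> on binary vectors; these formulas are affine for
  all real arguments.\<close>

definition multilabel_mean_confusion :: "real ^ 'm \<Rightarrow> real ^ 'm \<Rightarrow> real ^ bool ^ bool ^ 'm" where
  "multilabel_mean_confusion q p =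
     (\<chi> j u v. (if u then q $ j else 1 - q $ j) * of_bool (p $ j = of_bool v))"

text \<open>Each label contributes exactly one entry equal to 1, whence
  \<open>a = m\<close>.\<close>

lemma norm_multilabel_confusion:
  fixes y p :: "real ^ 'm"
  assumes "y \<in> binary_vectors" "p \<in> binary_vectors"
  shows "(norm (multilabel_confusion y p))\<^sup>2 = real CARD('m)"
proof -
  have "(\<Sum>u\<in>UNIV. \<Sum>v\<in>UNIV. (multilabel_confusion y p $ j $ u $ v)\<^sup>2) = 1" for j
  proof -
    have "y $ j \<in> {0, 1}" "p $ j \<in> {0, 1}" using assms by (simp_all add: binary_vectors_def)
    then show ?thesis by (auto simp: multilabel_confusion_def UNIV_bool)
  qed
  then show ?thesis by (simp add: power2_norm_eq_inner inner_vec_def flip: power2_eq_square)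
qed

text \<open>Each coordinate of \<open>q - r\<close> occurs twice, with opposite signs for the two
  values of \<open>u\<close>, at the single \<open>v\<close> that matches the prediction; this is
  the source of \<open>sqrt 2\<close>.\<close>

lemma norm_multilabel_mean_confusion_diff:
  assumes "p \<in> binary_vectors"
  shows "norm (multilabel_mean_confusion q p - multilabel_mean_confusion r p) = sqrt 2 * norm (q - r)"
proof -
  let ?d = "multilabel_mean_confusion q p - multilabel_mean_confusion r p"
  have "(\<Sum>u\<in>UNIV. \<Sum>v\<in>UNIV. (?d $ j $ u $ v)\<^sup>2) = 2 * ((q - r) $ j)\<^sup>2" for j
  proof -
    have "p $ j \<in> {0, 1}" using assms by (simp add: binary_vectors_def)
    then show ?thesis
      by (auto simp: multilabel_mean_confusion_def UNIV_bool power2_commute)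
  qed
  then have "(norm ?d)\<^sup>2 = 2 * (norm (q - r))\<^sup>2"
    by (simp add: power2_norm_eq_inner inner_vec_def sum_distrib_left flip: power2_eq_square
        del: vector_minus_component)
  then have "sqrt ((norm ?d)\<^sup>2) = sqrt (2 * (norm (q - r))\<^sup>2)" by (rule arg_cong)
  then show ?thesis by (simp add: real_sqrt_mult)
qed

lemma affine_confusion_multilabel:
  assumes P: "P \<subseteq> (binary_vectors :: (real ^ 'm) set)"
  shows "affine_confusion multilabel_confusion multilabel_mean_confusion
     binary_vectors P (real CARD('m)) (sqrt 2)"
proof (rule affine_confusion.intro)
  fix p :: "real ^ 'm"
  show "linear (\<lambda>q. multilabel_mean_confusion q p - multilabel_mean_confusion 0 p)"
    by (rule linearI) (simp_all add: multilabel_mean_confusion_def vec_eq_iff algebra_simps)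
next
  fix y p :: "real ^ 'm"
  assume "y \<in> binary_vectors" "p \<in> P"
  then have "y $ j \<in> {0, 1}" for j by (simp add: binary_vectors_def)
  then have "of_bool (y $ j = of_bool u) = (if u then y $ j else 1 - y $ j)" for j u
    by (smt (verit) insert_iff singletonD of_bool_eq)
  then show "multilabel_mean_confusion y p = multilabel_confusion y p"
    by (simp add: multilabel_mean_confusion_def multilabel_confusion_def)
next
  fix q p :: "real ^ 'm"
  assume "q \<in> convex hull binary_vectors" "p \<in> P"
  then show "expected_confusion multilabel_confusion binary_vectors q p = multilabel_mean_confusion q p"
    by (simp add: expected_multilabel_confusion multilabel_mean_confusion_def)
next
  fix p q r :: "real ^ 'm"
  assume "p \<in> P"
  then show "norm (multilabel_mean_confusion q p - multilabel_mean_confusion r p)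
      \<le> sqrt 2 * norm (q - r)"
    using P norm_multilabel_mean_confusion_diff[of p q r] by auto
next
  fix y y' p p' :: "real ^ 'm"
  assume *: "y \<in> binary_vectors" "y' \<in> binary_vectors" "p \<in> P" "p' \<in> P"
  have "0 \<le> multilabel_confusion y p \<bullet> multilabel_confusion y' p'"
    unfolding inner_vec_def by (intro sum_nonneg) (simp add: multilabel_confusion_def)
  from norm_diff_power2_le[OF this]
  show "(norm (multilabel_confusion y p - multilabel_confusion y' p'))\<^sup>2 \<le> 2 * real CARD('m)"
    using norm_multilabel_confusion[OF *(1) subsetD[OF P *(3)]]
      norm_multilabel_confusion[OF *(2) subsetD[OF P *(4)]] by linarith
qed (use P finite_binary_vectors finite_subset in blast)+

theorem theorem4p3:
  fixes X :: "'x measure"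
    and D1 D2 :: "('x \<times> (real ^ 'm)) measure"
    and \<eta>1 \<eta>2 hstar1 hstar2 :: "'x \<Rightarrow> real ^ 'm"
    and \<eta>h1 \<eta>h2 pred1 pred2 :: "nat \<Rightarrow> (nat \<Rightarrow> 'x \<times> (real ^ 'm)) \<Rightarrow> 'x \<Rightarrow> real ^ 'm"
    and P2 :: "(real ^ 'm) set"
    and \<psi>1 :: "real ^ 'm ^ 'm \<Rightarrow> real"
    and grad1 :: "real ^ 'm ^ 'm \<Rightarrow> real ^ 'm ^ 'm"
    and C1 :: "real ^ 'm ^ 'm"
    and \<psi>2 :: "real ^ bool ^ bool ^ 'm \<Rightarrow> real"
    and grad2 :: "real ^ bool ^ bool ^ 'm \<Rightarrow> real ^ bool ^ bool ^ 'm"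
    and C2 :: "real ^ bool ^ bool ^ 'm"
    and L M :: real
    and n :: nat
  assumes "n \<ge> 1"
  shows
    "(data_distribution X one_hot_vectors D1 \<and>
      conditional_label_mean X D1 \<eta>1 \<and>
      online_estimator X one_hot_vectors D1 n \<eta>h1 \<and>
      concave_smooth_utility
        (achievable_confusions multiclass_confusion one_hot_vectors one_hot_vectors) \<psi>1 grad1 L M \<and>
      C1 \<in> achievable_confusions multiclass_confusion one_hot_vectors one_hot_vectors \<and>
      omma multiclass_confusion X one_hot_vectors one_hot_vectors D1 n grad1 C1 \<eta>h1 pred1 \<and>
      optimal_classifier multiclass_confusion X one_hot_vectors D1 n \<psi>1 hstar1
      \<longrightarrow>
      regret multiclass_confusion D1 n \<psi>1 hstar1 pred1
        \<le> M * (1 + ln (real n)) / real n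
          + 2 * L / real n * (\<Sum>t = 1..n. estimation_error D1 n \<eta>1 \<eta>h1 t))
     \<and>
     ((P2 = binary_vectors \<or> (\<exists>k. P2 = budgeted_vectors k)) \<and>
      data_distribution X binary_vectors D2 \<and>
      conditional_label_mean X D2 \<eta>2 \<and>
      online_estimator X binary_vectors D2 n \<eta>h2 \<and>
      concave_smooth_utility
        (achievable_confusions multilabel_confusion binary_vectors P2) \<psi>2 grad2 L M \<and>
      C2 \<in> achievable_confusions multilabel_confusion binary_vectors P2 \<and>
      omma multilabel_confusion X binary_vectors P2 D2 n grad2 C2 \<eta>h2 pred2 \<and>
      optimal_classifier multilabel_confusion X P2 D2 n \<psi>2 hstar2
      \<longrightarrow>
      regret multilabel_confusion D2 n \<psi>2 hstar2 pred2
        \<le> M * real CARD('m) * (1 + ln (real n)) / real n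
          + 2 * sqrt 2 * L / real n * (\<Sum>t = 1..n. estimation_error D2 n \<eta>2 \<eta>h2 t))"
proof (intro conjI impI)
  assume "data_distribution X one_hot_vectors D1 \<and>
      conditional_label_mean X D1 \<eta>1 \<and>
      online_estimator X one_hot_vectors D1 n \<eta>h1 \<and>
      concave_smooth_utility
        (achievable_confusions multiclass_confusion one_hot_vectors one_hot_vectors) \<psi>1 grad1 L M \<and>
      C1 \<in> achievable_confusions multiclass_confusion one_hot_vectors one_hot_vectors \<and>
      omma multiclass_confusion X one_hot_vectors one_hot_vectors D1 n grad1 C1 \<eta>h1 pred1 \<and>
      optimal_classifier multiclass_confusion X one_hot_vectors D1 n \<psi>1 hstar1"
  \<comment> \<open>An optimal classifier is in particular measurable into the allowed predictions,
    so it can take the place of the comparator \<open>h\<close>.\<close>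
  then have "omma_run multiclass_confusion multiclass_confusion one_hot_vectors one_hot_vectors 1 1
      X D1 \<eta>1 n \<psi>1 grad1 L M C1 \<eta>h1 pred1 hstar1"
    using assms
    by (intro omma_run.intro label_model.intro label_model_axioms.intro omma_run_axioms.intro
        affine_confusion_multiclass) (auto simp: optimal_classifier_def is_arg_max_def)
  from omma_run.regret_bound[OF this]
  show "regret multiclass_confusion D1 n \<psi>1 hstar1 pred1
        \<le> M * (1 + ln (real n)) / real n
          + 2 * L / real n * (\<Sum>t = 1..n. estimation_error D1 n \<eta>1 \<eta>h1 t)"
    by simp
next
  assume *: "(P2 = binary_vectors \<or> (\<exists>k. P2 = budgeted_vectors k)) \<and>
      data_distribution X binary_vectors D2 \<and>
      conditional_label_mean X D2 \<eta>2 \<and>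
      online_estimator X binary_vectors D2 n \<eta>h2 \<and>
      concave_smooth_utility
        (achievable_confusions multilabel_confusion binary_vectors P2) \<psi>2 grad2 L M \<and>
      C2 \<in> achievable_confusions multilabel_confusion binary_vectors P2 \<and>
      omma multilabel_confusion X binary_vectors P2 D2 n grad2 C2 \<eta>h2 pred2 \<and>
      optimal_classifier multilabel_confusion X P2 D2 n \<psi>2 hstar2"
  then have "P2 \<subseteq> binary_vectors" by (auto simp: budgeted_vectors_def)
  with * have "omma_run multilabel_confusion multilabel_mean_confusion binary_vectors P2
      (real CARD('m)) (sqrt 2) X D2 \<eta>2 n \<psi>2 grad2 L M C2 \<eta>h2 pred2 hstar2"
    using assms
    by (intro omma_run.intro label_model.intro label_model_axioms.intro omma_run_axioms.intro
        affine_confusion_multilabel) (auto simp: optimal_classifier_def is_arg_max_def)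
  from omma_run.regret_bound[OF this]
  show "regret multilabel_confusion D2 n \<psi>2 hstar2 pred2
        \<le> M * real CARD('m) * (1 + ln (real n)) / real n
          + 2 * sqrt 2 * L / real n * (\<Sum>t = 1..n. estimation_error D2 n \<eta>2 \<eta>h2 t)" .
qed

end
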